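(* Fix $\tau\ge0$ and $\theta\in\mathbb{R}$. Suppose $\mathbf{Z}=(Z_t)_{t>0}\in QH(0,\theta;0,\tau;1)$ (i.e. $\mathbf{Z}$ is a Meixner process). Let $0\le r<v<\infty$ and let $\mathbf{X}=(X_t)_{t\in(r,v)}$ be a bridge of $\mathbf{Z}$ between points $(r,z_r)$ and $(v,z_v)$. Put $\Delta=\frac{z_v-z_r}{v-r}$ and assume $1+\theta\Delta+\tau\Delta^2>0$. Let $$Y_t=\frac{\sqrt{v-r+\tau}}{(v-r)\sqrt{1+\theta\Delta+\tau\Delta^2}}\Big((1+t)X_{(vt+r)/(1+t)}-tz_v-z_r\Big),\qquad t\in(0,\infty).$$ Then $\mathbf{Y}=(Y_t)_{t>0}\in QH(\eta_Y,\theta_Y;\sigma_Y,\tau_Y;\gamma_Y)$ with parameters $$\gamma_Y=\frac{v-r-\tau}{v-r+\tau},\qquad \tau_Y=\sigma_Y=\frac{\tau}{v-r+\tau},$$ $$\theta_Y=-\eta_Y=\frac{\theta+2\tau\Delta}{\sqrt{v-r+\tau}\,\sqrt{1+\theta\Delta+\tau\Delta^2}}.$$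
   Context: **Natural past-future filtration.** For a process $(X_t)_{t\in\mathcal{T}}$ on an open interval $\mathcal{T}$: $\mathcal{F}_{s,t}=\sigma(X_r: r\in\mathcal{T},\ r\le s\text{ or }r\ge t)$ for $s<t$ in $\mathcal{T}$. **Notation $QH$.** $\mathbf{X}\in QH(\eta,\theta;\sigma,\tau;\gamma)$ on $\mathcal{T}\subset(0,\infty)$ means that $\mathbf{X}=(X_t)_{t\in\mathcal{T}}$ is square-integrable, $\mathbb{E}(X_t)=0$, $\mathbb{E}(X_sX_t)=\min\{s,t\}$, for all $s<t<u$ in $\mathcal{T}$ $$\mathbb{E}(X_t|\mathcal{F}_{s,u})=\frac{u-t}{u-s}X_s+\frac{t-s}{u-s}X_u,$$ and there is a non-random function $F_{t,s,u}$ of $s<t<u$ such that $$\operatorname{Var}(X_t|\mathcal{F}_{s,u})=F_{t,s,u}\Big(1+\eta\tfrac{uX_s-sX_u}{u-s}+\theta\tfrac{X_u-X_s}{u-s}+\sigma\tfrac{(uX_s-sX_u)^2}{(u-s)^2}+\tau\tfrac{(X_u-X_s)^2}{(u-s)^2}-(1-\gamma)\tfrac{(X_u-X_s)(uX_s-sX_u)}{(u-s)^2}\Big),$$ with $(\mathcal{F}_{s,u})$ the natural past-future filtration. **Bridge.** A process $(X_t)_{t\in(r,v)}$ is a bridge between points $(r,z_r)$ and $(v,z_v)$ of a process $(Z_t)_{t\in\mathcal{T}}$ with $(r,v)\subset\mathcal{T}$ if: (1) $\lim_{t\to r^+}X_t=z_r$ and $\lim_{t\to v^-}X_t=z_v$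 in probability; (2) for $r<t_1<\dots<t_m<v$ the law of $(X_{t_1},\dots,X_{t_m})$ is absolutely continuous with respect to the law of $(Z_{t_1},\dots,Z_{t_m})$; (3) for $r<s_1<\dots<s_k<t_1<\dots<t_m<u_1<\dots<u_n<v$, writing $Z_{\mathbf t}=(Z_{t_1},\dots,Z_{t_m})$ etc., and any function $g$ with $g(Z_{\mathbf t})$ integrable, if $\mathbb{E}(g(Z_{\mathbf t})|Z_{\mathbf s},Z_{\mathbf u})=h(Z_{\mathbf s},Z_{\mathbf u})$ a.s., then $\mathbb{E}(g(X_{\mathbf t})|X_{\mathbf s},X_{\mathbf u})=h(X_{\mathbf s},X_{\mathbf u})$ a.s. (conditional expectation in the extended sense if $g(X_{\mathbf t})$ is not integrable). *)

theory Defs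
  imports "HOL-Probability.Probability"
begin

text \<open>
  A stochastic process on an index set \<open>T\<close> is a map \<open>X :: real \<Rightarrow> 'a \<Rightarrow> real\<close>; the values
  \<open>X t\<close> for \<open>t \<notin> T\<close> play no role. All definitions are meant for a probability space \<open>M\<close>.
\<close>

definition sigma_of :: "'a measure \<Rightarrow> (real \<Rightarrow> 'a \<Rightarrow> real) \<Rightarrow> real set \<Rightarrow> 'a measure" where
  "sigma_of M X I = sigma (space M) {X i -` A \<inter> space M | i A. i \<in> I \<and> A \<in> sets borel}"

definition past_future ::
    "'a measure \<Rightarrow> real set \<Rightarrow> (real \<Rightarrow> 'a \<Rightarrow> real) \<Rightarrow> real \<Rightarrow> real \<Rightarrow> 'a measure" where
  "past_future M T X s t = sigma_of M X {r \<in> T. r \<le> s \<or> t \<le> r}"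

definition cond_var :: "'a measure \<Rightarrow> 'a measure \<Rightarrow> ('a \<Rightarrow> real) \<Rightarrow> 'a \<Rightarrow> real" where
  "cond_var M F X = real_cond_exp M F (\<lambda>\<omega>. (X \<omega> - real_cond_exp M F X \<omega>)\<^sup>2)"

definition QH ::
    "'a measure \<Rightarrow> real set \<Rightarrow> (real \<Rightarrow> 'a \<Rightarrow> real) \<Rightarrow> real \<Rightarrow> real \<Rightarrow> real \<Rightarrow> real \<Rightarrow> real \<Rightarrow> bool" where
  "QH M T X \<eta> \<theta> \<sigma> \<tau> \<gamma> \<longleftrightarrow>
     open T \<and> is_interval T \<and> T \<noteq> {} \<and> T \<subseteq> {0<..} \<and>
     (\<forall>t\<in>T. X t \<in> borel_measurable M \<and> integrable M (\<lambda>\<omega>. (X t \<omega>)\<^sup>2)) \<and>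
     (\<forall>t\<in>T. (\<integral>\<omega>. X t \<omega> \<partial>M) = 0) \<and>
     (\<forall>s\<in>T. \<forall>t\<in>T. (\<integral>\<omega>. X s \<omega> * X t \<omega> \<partial>M) = min s t) \<and>
     (\<forall>s\<in>T. \<forall>t\<in>T. \<forall>u\<in>T. s < t \<longrightarrow> t < u \<longrightarrow>
        (AE \<omega> in M. real_cond_exp M (past_future M T X s u) (X t) \<omega> =
           (u - t) / (u - s) * X s \<omega> + (t - s) / (u - s) * X u \<omega>)) \<and>
     (\<exists>F :: real \<Rightarrow> real \<Rightarrow> real \<Rightarrow> real.
        \<forall>s\<in>T. \<forall>t\<in>T. \<forall>u\<in>T. s < t \<longrightarrow> t < u \<longrightarrow>
        (AE \<omega> in M. cond_var M (past_future M T X s u) (X t) \<omega> =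
           F t s u *
             (1 + \<eta> * ((u * X s \<omega> - s * X u \<omega>) / (u - s))
                + \<theta> * ((X u \<omega> - X s \<omega>) / (u - s))
                + \<sigma> * ((u * X s \<omega> - s * X u \<omega>)\<^sup>2 / (u - s)\<^sup>2)
                + \<tau> * ((X u \<omega> - X s \<omega>)\<^sup>2 / (u - s)\<^sup>2)
                - (1 - \<gamma>) * ((X u \<omega> - X s \<omega>) * (u * X s \<omega> - s * X u \<omega>) / (u - s)\<^sup>2))))"

definition tendsto_in_prob ::
    "'a measure \<Rightarrow> ('i \<Rightarrow> 'a \<Rightarrow> real) \<Rightarrow> real \<Rightarrow> 'i filter \<Rightarrow> bool" where
  "tendsto_in_prob M X c G \<longleftrightarrow>
     (\<forall>\<epsilon>>0. ((\<lambda>t. measure M {\<omega> \<in> space M. \<bar>X t \<omega> - c\<bar> > \<epsilon>}) \<longlongrightarrow> 0) G)"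

text \<open>
  The random vector of the values of \<open>X\<close> at the times in \<open>I\<close>. A strictly increasing tuple of times
  is encoded as the finite set \<open>I\<close> of its entries.
\<close>
definition sample :: "(real \<Rightarrow> 'a \<Rightarrow> real) \<Rightarrow> real set \<Rightarrow> 'a \<Rightarrow> real \<Rightarrow> real" where
  "sample X I \<omega> = (\<lambda>i\<in>I. X i \<omega>)"

definition law :: "'a measure \<Rightarrow> (real \<Rightarrow> 'a \<Rightarrow> real) \<Rightarrow> real set \<Rightarrow> (real \<Rightarrow> real) measure" where
  "law M X I = distr M (\<Pi>\<^sub>M i\<in>I. borel) (sample X I)"

text \<open>
  \<open>E(f | F) = h\<close> in the extended sense: \<open>f\<close> need not be integrable, but the conditional expectations
  of its positive and negative parts (which always exist in \<open>[0, \<infinity>]\<close>) are almost surely finite and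
  \<open>h\<close> is their difference. Since \<open>ennreal\<close> truncates negative reals to 0, \<open>ennreal (f \<omega>)\<close> and
  \<open>ennreal (- f \<omega>)\<close> are these parts; \<open>real_cond_exp\<close> is the difference by definition. For
  integrable \<open>f\<close> the finiteness holds automatically.
\<close>
definition ext_cond_exp_eq ::
    "'a measure \<Rightarrow> 'a measure \<Rightarrow> ('a \<Rightarrow> real) \<Rightarrow> ('a \<Rightarrow> real) \<Rightarrow> bool" where
  "ext_cond_exp_eq M F f h \<longleftrightarrow>
     (AE \<omega> in M. nn_cond_exp M F (\<lambda>\<omega>. ennreal (f \<omega>)) \<omega> < \<infinity> \<and>
                 nn_cond_exp M F (\<lambda>\<omega>. ennreal (- f \<omega>)) \<omega> < \<infinity> \<and>
                 real_cond_exp M F f \<omega> = h \<omega>)"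

text \<open>
  \<open>bridge N X r zr v zv M T Z\<close>: the process \<open>X\<close> on \<open>(r, v)\<close>, defined on the probability space
  \<open>N\<close>, is a bridge between \<open>(r, zr)\<close> and \<open>(v, zv)\<close> of the process \<open>Z\<close> on \<open>T\<close>, defined on the
  (possibly different) probability space \<open>M\<close>. In the last clause all three tuples of times are
  nonempty, so that the conditioning is on both past and future.
\<close>
definition bridge ::
    "'b measure \<Rightarrow> (real \<Rightarrow> 'b \<Rightarrow> real) \<Rightarrow> real \<Rightarrow> real \<Rightarrow> real \<Rightarrow> real \<Rightarrow>
     'a measure \<Rightarrow> real set \<Rightarrow> (real \<Rightarrow> 'a \<Rightarrow> real) \<Rightarrow> bool" where
  "bridge N X r zr v zv M T Z \<longleftrightarrow>
     {r<..<v} \<subseteq> T \<and>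
     (\<forall>t\<in>{r<..<v}. X t \<in> borel_measurable N) \<and>
     tendsto_in_prob N X zr (at_right r) \<and>
     tendsto_in_prob N X zv (at_left v) \<and>
     (\<forall>I. finite I \<longrightarrow> I \<noteq> {} \<longrightarrow> I \<subseteq> {r<..<v} \<longrightarrow> absolutely_continuous (law M Z I) (law N X I)) \<and>
     (\<forall>S I U. \<forall>g \<in> borel_measurable (\<Pi>\<^sub>M i\<in>I. borel).
        \<forall>h \<in> borel_measurable ((\<Pi>\<^sub>M i\<in>S. borel) \<Otimes>\<^sub>M (\<Pi>\<^sub>M i\<in>U. borel)).
        finite S \<longrightarrow> finite I \<longrightarrow> finite U \<longrightarrow> S \<noteq> {} \<longrightarrow> I \<noteq> {} \<longrightarrow> U \<noteq> {} \<longrightarrow>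
        S \<subseteq> {r<..<v} \<longrightarrow> I \<subseteq> {r<..<v} \<longrightarrow> U \<subseteq> {r<..<v} \<longrightarrow>
        (\<forall>s\<in>S. \<forall>t\<in>I. s < t) \<longrightarrow> (\<forall>t\<in>I. \<forall>u\<in>U. t < u) \<longrightarrow>
        integrable M (\<lambda>\<omega>. g (sample Z I \<omega>)) \<longrightarrow>
        (AE \<omega> in M. real_cond_exp M (sigma_of M Z (S \<union> U)) (\<lambda>\<omega>. g (sample Z I \<omega>)) \<omega> =
                    h (sample Z S \<omega>, sample Z U \<omega>)) \<longrightarrow>
        ext_cond_exp_eq N (sigma_of N X (S \<union> U)) (\<lambda>\<omega>. g (sample X I \<omega>))
          (\<lambda>\<omega>. h (sample X S \<omega>, sample X U \<omega>)))"

end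

theory Submission
  imports Defs
begin

text \<open>
  For \<open>s < t < u\<close> the first two conditional moments of a Meixner process given its past up to \<open>s\<close> and
  its future from \<open>u\<close> are explicit functions of the values at \<open>s\<close> and \<open>u\<close> only, and the bridge inherits
  both formulas for finitely many conditioning times. Letting \<open>s \<rightarrow> r\<close> and \<open>u \<rightarrow> v\<close>, where the bridge is
  pinned, these conditional moments converge to constants: this shows that the bridge is square
  integrable and gives its mean and variance; pinning the right end alone gives the covariance. An
  affine change of variables and the time change \<open>t \<mapsto> (v t + r) / (1 + t)\<close> then turn the conditional
  variance into a quadratic form in the new increments, whose coefficients are the new parameters.
\<close>

section \<open>Conditioning on sigma-algebras generated by a process\<close>

text \<open>The bridge property transfers identities E(g(Z_t) | finitely many values) = h for a
  fixed function g. Hence second moments are carried over rather than variances. The definition of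
  \<open>QH\<close> only asserts that some non-random factor F exists; for \<open>Z\<close> it has
  to be computed, since the limit at the end points needs its continuity in s and u. Two obstacles
  shape the limit: the transferred identities hold only in the extended sense, and the end points
  are approached only in probability. Both are overcome by selecting times along which convergence
  is almost sure, and by truncating to events of the conditioning sigma-algebra on which the
  conditional moment is within 1 of its limit. With c = 1 + \<theta> \<Delta> + \<tau> \<Delta>^2,
  the limiting variance of X_t is c (t - r)(v - t)/(v - r + \<tau>). At the changed time this equals
  c (v - r)^2 t / ((v - r + \<tau>)(1 + t)^2), which explains the prefactor of \<open>Y\<close>: it
  makes the variance of Y_t equal to t.\<close>

lemma space_sigma_of [simp]: "space (sigma_of M X I) = space M"
  unfolding sigma_of_def by (simp add: space_measure_of_conv)

lemma sets_sigma_of: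
  "sets (sigma_of M X I) =
     sigma_sets (space M) {X i -` A \<inter> space M | i A. i \<in> I \<and> A \<in> sets borel}"
  unfolding sigma_of_def by (rule sets_measure_of) auto

lemma subalgebra_sigma_of:
  assumes "\<And>i. i \<in> I \<Longrightarrow> X i \<in> borel_measurable M"
  shows "subalgebra M (sigma_of M X I)"
proof -
  have "sigma_sets (space M) {X i -` A \<inter> space M | i A. i \<in> I \<and> A \<in> sets borel} \<subseteq> sets M"
    by (rule sets.sigma_sets_subset) (use assms measurable_sets in blast)
  then show ?thesis by (simp add: subalgebra_def sets_sigma_of)
qed

lemma measurable_sigma_of:
  assumes "i \<in> I" shows "X i \<in> borel_measurable (sigma_of M X I)"
  using assms by (intro measurableI) (auto simp: sets_sigma_of intro!: sigma_sets.Basic)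

lemma sets_sigma_of_mono:
  assumes "I \<subseteq> J" shows "sets (sigma_of M X I) \<subseteq> sets (sigma_of M X J)"
  unfolding sets_sigma_of using assms by (intro sigma_sets_mono') blast

lemma subalgebra_sigma_of_mono:
  "I \<subseteq> J \<Longrightarrow> subalgebra (sigma_of M X J) (sigma_of M X I)"
  by (simp add: subalgebra_def sets_sigma_of_mono)

lemma (in prob_space) finite_measure_subalgebra_sigma_of:
  assumes "\<And>i. i \<in> I \<Longrightarrow> X i \<in> borel_measurable M"
  shows "finite_measure_subalgebra M (sigma_of M X I)"
  by unfold_locales (rule subalgebra_sigma_of[OF assms])

text \<open>Affine bijections of the line carry Borel sets to Borel sets, so both processes have the
  same generating preimages. This identifies the past-future filtration of a time-changed affine
  image with that of the original process.\<close>

lemma sigma_of_reparametrize: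
  fixes a b :: "real \<Rightarrow> real"
  assumes Y: "\<And>i \<omega>. i \<in> I \<Longrightarrow> \<omega> \<in> space M \<Longrightarrow> Y i \<omega> = a i * X (\<phi> i) \<omega> + b i"
    and a: "\<And>i. i \<in> I \<Longrightarrow> a i \<noteq> 0" and J: "J = \<phi> ` I"
  shows "sigma_of M Y I = sigma_of M X J"
proof -
  have "(\<exists>i A. B = Y i -` A \<inter> space M \<and> i \<in> I \<and> A \<in> sets borel) \<longleftrightarrow>
      (\<exists>j A. B = X j -` A \<inter> space M \<and> j \<in> J \<and> A \<in> sets borel)" for B
  proof safe
    fix i and A :: "real set" assume i: "i \<in> I" and [measurable]: "A \<in> sets borel"
    have "Y i -` A \<inter> space M = X (\<phi> i) -` ((\<lambda>x. a i * x + b i) -` A \<inter> space borel) \<inter> space M"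
      using Y[OF i] by auto
    moreover have "(\<lambda>x. a i * x + b i) -` A \<inter> space borel \<in> sets borel" by measurable
    ultimately show "\<exists>j A'. Y i -` A \<inter> space M = X j -` A' \<inter> space M \<and> j \<in> J \<and> A' \<in> sets borel"
      using i J by (intro exI[of _ "\<phi> i"] exI conjI) auto
  next
    fix j and A :: "real set" assume "j \<in> J" and [measurable]: "A \<in> sets borel"
    then obtain i where i: "i \<in> I" "j = \<phi> i" using J by auto
    have "X j \<omega> = (Y i \<omega> - b i) / a i" if "\<omega> \<in> space M" for \<omega>
      using Y[OF i(1) that] a[OF i(1)] i(2) by simp
    then have "X j -` A \<inter> space M = Y i -` ((\<lambda>x. (x - b i) / a i) -` A \<inter> space borel) \<inter> space M"
      by auto
    moreover have "(\<lambda>x. (x - b i) / a i) -` A \<inter> space borel \<in> sets borel" by measurable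
    ultimately show "\<exists>i A'. X j -` A \<inter> space M = Y i -` A' \<inter> space M \<and> i \<in> I \<and> A' \<in> sets borel"
      using i(1) by (intro exI[of _ i] exI conjI)
  qed
  then show ?thesis
    unfolding sigma_of_def by (intro arg_cong[where f = "sigma (space M)"] Collect_cong)
qed

text \<open>The events that depend on finitely many times form an \<open>\<inter>\<close>-stable generator, so an
  identity of conditional expectations given finitely many times passes to all times.\<close>

lemma (in prob_space) real_cond_exp_sigma_of_finite:
  assumes X: "\<And>i. i \<in> K \<Longrightarrow> X i \<in> borel_measurable M"
    and f: "integrable M f" and h: "integrable M h"
    and J0: "finite J0" "J0 \<subseteq> K" and hm: "h \<in> borel_measurable (sigma_of M X J0)"
    and fin: "\<And>J. finite J \<Longrightarrow> J0 \<subseteq> J \<Longrightarrow> J \<subseteq> K \<Longrightarrow>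
      AE \<omega> in M. real_cond_exp M (sigma_of M X J) f \<omega> = h \<omega>"
  shows "AE \<omega> in M. real_cond_exp M (sigma_of M X K) f \<omega> = h \<omega>"
proof -
  interpret F: finite_measure_subalgebra M "sigma_of M X K"
    by (rule finite_measure_subalgebra_sigma_of[OF X])
  define G where "G = (\<Union>J\<in>{J. finite J \<and> J0 \<subseteq> J \<and> J \<subseteq> K}. sets (sigma_of M X J))"
  have GF: "G \<subseteq> sets (sigma_of M X K)"
    unfolding G_def using sets_sigma_of_mono[of _ K M X] by blast
  have KM: "sets (sigma_of M X K) \<subseteq> sets M"
    using F.subalg by (simp add: subalgebra_def)
  have GM: "sigma_sets (space M) G \<subseteq> sets M"
    by (rule sets.sigma_sets_subset) (use GF KM in blast)
  have GP: "G \<subseteq> Pow (space M)" using GF KM sets.sets_into_space by blast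
  have "X i -` A \<inter> space M \<in> G" if "i \<in> K" "A \<in> sets borel" for i A
  proof -
    have "X i -` A \<inter> space M \<in> sets (sigma_of M X (insert i J0))"
      using that by (auto simp: sets_sigma_of intro!: sigma_sets.Basic)
    then show ?thesis unfolding G_def using that J0 by blast
  qed
  then have sub: "sets (sigma_of M X K) \<subseteq> sigma_sets (space M) G"
    unfolding sets_sigma_of by (intro sigma_sets_mono) auto
  have "Int_stable G"
  proof (rule Int_stableI)
    fix A B assume "A \<in> G" "B \<in> G"
    then obtain J1 J2 where J: "finite J1" "J0 \<subseteq> J1" "J1 \<subseteq> K" "A \<in> sets (sigma_of M X J1)"
      "finite J2" "J0 \<subseteq> J2" "J2 \<subseteq> K" "B \<in> sets (sigma_of M X J2)"
      unfolding G_def by auto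
    have "A \<in> sets (sigma_of M X (J1 \<union> J2))" "B \<in> sets (sigma_of M X (J1 \<union> J2))"
      using J sets_sigma_of_mono[of _ "J1 \<union> J2" M X] by blast+
    then have "A \<inter> B \<in> sets (sigma_of M X (J1 \<union> J2))" by auto
    then show "A \<inter> B \<in> G" unfolding G_def using J by blast
  qed
  have eq: "(\<integral>\<omega>\<in>A. f \<omega> \<partial>M) = (\<integral>\<omega>\<in>A. h \<omega> \<partial>M)" if "A \<in> sigma_sets (space M) G" for A
    using \<open>Int_stable G\<close> GP that
  proof (induction rule: sigma_sets_induct_disjoint)
    case (basic A)
    then obtain J where J: "finite J" "J0 \<subseteq> J" "J \<subseteq> K" "A \<in> sets (sigma_of M X J)"
      unfolding G_def by auto
    interpret J: finite_measure_subalgebra M "sigma_of M X J"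
      by (rule finite_measure_subalgebra_sigma_of) (use X J in auto)
    have [measurable]: "A \<in> sets M" using J(4) J.subalg by (auto simp: subalgebra_def)
    have [measurable]: "f \<in> borel_measurable M" "h \<in> borel_measurable M" using f h by auto
    have "(\<integral>\<omega>\<in>A. f \<omega> \<partial>M) = (\<integral>\<omega>\<in>A. real_cond_exp M (sigma_of M X J) f \<omega> \<partial>M)"
      by (rule J.real_cond_exp_intA[OF f J(4)])
    also have "\<dots> = (\<integral>\<omega>\<in>A. h \<omega> \<partial>M)"
      unfolding set_lebesgue_integral_def
      by (rule integral_cong_AE, measurable) (use fin[OF J(1-3)] in auto)
    finally show ?case .
  next
    case empty
    then show ?case by (simp add: set_lebesgue_integral_def)
  next
    case (compl A)
    have A: "A \<in> sets M" using compl(1) GM by blast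
    have *: "(\<integral>\<omega>\<in>space M - A. g \<omega> \<partial>M) = (\<integral>\<omega>. g \<omega> \<partial>M) - (\<integral>\<omega>\<in>A. g \<omega> \<partial>M)"
      if g: "integrable M g" for g :: "'a \<Rightarrow> real"
    proof -
      have "integrable M (\<lambda>\<omega>. indicator A \<omega> *\<^sub>R g \<omega>)"
        by (rule integrable_mult_indicator[OF A g])
      then have "(\<integral>\<omega>. g \<omega> \<partial>M) - (\<integral>\<omega>\<in>A. g \<omega> \<partial>M) = (\<integral>\<omega>. g \<omega> - indicator A \<omega> *\<^sub>R g \<omega> \<partial>M)"
        unfolding set_lebesgue_integral_def using g by simp
      also have "\<dots> = (\<integral>\<omega>\<in>space M - A. g \<omega> \<partial>M)"
        unfolding set_lebesgue_integral_def
        by (intro Bochner_Integration.integral_cong) (auto simp: indicator_def)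
      finally show ?thesis by simp
    qed
    \<comment> \<open>Complements require equal total integrals; conditioning on the finite set
      \<open>J0\<close> itself provides them.\<close>
    have "(\<integral>\<omega>. f \<omega> \<partial>M) = (\<integral>\<omega>. h \<omega> \<partial>M)"
    proof -
      interpret J: finite_measure_subalgebra M "sigma_of M X J0"
        by (rule finite_measure_subalgebra_sigma_of) (use X J0 in auto)
      have "(\<integral>\<omega>. f \<omega> \<partial>M) = (\<integral>\<omega>. real_cond_exp M (sigma_of M X J0) f \<omega> \<partial>M)"
        using J.real_cond_exp_int(2)[OF f] by simp
      also have "\<dots> = (\<integral>\<omega>. h \<omega> \<partial>M)"
        by (rule integral_cong_AE) (use fin[of J0] J0 h in simp_all)
      finally show ?thesis .
    qed
    then show ?case using *[OF f] *[OF h] compl by simp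
  next
    case (union A)
    have A: "A i \<in> sets M" for i using union(2) GM by blast
    have *: "(\<integral>\<omega>\<in>(\<Union>i. A i). g \<omega> \<partial>M) = (\<Sum>i. (\<integral>\<omega>\<in>A i. g \<omega> \<partial>M))"
      if g: "integrable M g" for g :: "'a \<Rightarrow> real"
    proof (rule lebesgue_integral_countable_add)
      show "set_integrable M (\<Union>(range A)) g"
        unfolding set_integrable_def using A by (intro integrable_mult_indicator[OF _ g]) auto
    qed (rule A, use union(1) in \<open>simp add: disjoint_family_on_def\<close>)
    show ?case unfolding *[OF f] *[OF h] using union by simp
  qed
  have "h \<in> borel_measurable (sigma_of M X K)"
    by (rule measurable_from_subalg[OF subalgebra_sigma_of_mono[OF J0(2)] hm])
  then show ?thesis
    by (intro F.real_cond_exp_charact f h) (rule eq, rule subsetD[OF sub])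
qed

section \<open>Products of square-integrable functions\<close>

lemma integrable_mult_of_squares:
  fixes f g :: "'a \<Rightarrow> real"
  assumes [measurable]: "f \<in> borel_measurable M" "g \<in> borel_measurable M"
    and "integrable M (\<lambda>x. (f x)\<^sup>2)" "integrable M (\<lambda>x. (g x)\<^sup>2)"
  shows "integrable M (\<lambda>x. f x * g x)"
proof (rule Bochner_Integration.integrable_bound)
  show "integrable M (\<lambda>x. (f x)\<^sup>2 + (g x)\<^sup>2)" using assms by simp
  have "\<bar>f x * g x\<bar> \<le> (f x)\<^sup>2 + (g x)\<^sup>2" for x
  proof -
    have "2 * (f x * g x) \<le> (f x)\<^sup>2 + (g x)\<^sup>2" "- 2 * (f x * g x) \<le> (f x)\<^sup>2 + (g x)\<^sup>2"
      using sum_squares_bound[of "f x" "g x"] sum_squares_bound[of "- f x" "g x"] by simp_all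
    then show ?thesis by linarith
  qed
  then show "AE x in M. norm (f x * g x) \<le> norm ((f x)\<^sup>2 + (g x)\<^sup>2)" by simp
qed simp

lemma integrable_square_lincomb:
  fixes f g :: "'a \<Rightarrow> real"
  assumes "f \<in> borel_measurable M" "g \<in> borel_measurable M"
    and "integrable M (\<lambda>x. (f x)\<^sup>2)" "integrable M (\<lambda>x. (g x)\<^sup>2)"
  shows "integrable M (\<lambda>x. (a * f x + b * g x)\<^sup>2)"
proof -
  have "(a * f x + b * g x)\<^sup>2 = a\<^sup>2 * (f x)\<^sup>2 + b\<^sup>2 * (g x)\<^sup>2 + 2 * a * b * (f x * g x)" for x
    by (simp add: power2_eq_square algebra_simps)
  then show ?thesis using assms integrable_mult_of_squares[OF assms] by simp
qed

lemma integral_Cauchy_Schwarz: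
  fixes f g :: "'a \<Rightarrow> real"
  assumes m: "f \<in> borel_measurable M" "g \<in> borel_measurable M"
    and f: "integrable M (\<lambda>x. (f x)\<^sup>2)" and g: "integrable M (\<lambda>x. (g x)\<^sup>2)"
  shows "(\<integral>x. f x * g x \<partial>M)\<^sup>2 \<le> (\<integral>x. (f x)\<^sup>2 \<partial>M) * (\<integral>x. (g x)\<^sup>2 \<partial>M)"
proof -
  note fg = integrable_mult_of_squares[OF m f g]
  define A B C where "A = (\<integral>x. (f x)\<^sup>2 \<partial>M)" and "B = (\<integral>x. (g x)\<^sup>2 \<partial>M)"
    and "C = (\<integral>x. f x * g x \<partial>M)"
  \<comment> \<open>The integral of (x f - g)^2 is minimal at x = C/A; multiplying by
    \<open>A\<close> avoids the division and leaves \<open>A = 0\<close> as a separate case.\<close>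
  have "0 \<le> (\<integral>x. (C * f x - A * g x)\<^sup>2 \<partial>M)" by simp
  also have "(\<lambda>x. (C * f x - A * g x)\<^sup>2)
      = (\<lambda>x. C\<^sup>2 * (f x)\<^sup>2 + A\<^sup>2 * (g x)\<^sup>2 - 2 * A * C * (f x * g x))"
    by (simp add: fun_eq_iff power2_eq_square algebra_simps)
  also have "(\<integral>x. C\<^sup>2 * (f x)\<^sup>2 + A\<^sup>2 * (g x)\<^sup>2 - 2 * A * C * (f x * g x) \<partial>M)
      = C\<^sup>2 * A + A\<^sup>2 * B - 2 * A * C * C"
    using f g fg by (simp add: A_def B_def C_def)
  also have "\<dots> = A * (A * B - C\<^sup>2)" by (simp add: power2_eq_square algebra_simps)
  finally have *: "0 \<le> A * (A * B - C\<^sup>2)" .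
  have "0 \<le> A" unfolding A_def by simp
  show ?thesis
  proof (cases "A = 0")
    case True
    have "AE x in M. (f x)\<^sup>2 = 0"
      using True f unfolding A_def by (subst (asm) integral_nonneg_eq_0_iff_AE) auto
    then have "AE x in M. f x * g x = 0" by eventually_elim simp
    then have "C = 0" unfolding C_def by (intro integral_eq_zero_AE)
    then show ?thesis using True by (simp add: A_def C_def)
  next
    case False
    with \<open>0 \<le> A\<close> * have "0 \<le> A * B - C\<^sup>2" by (simp add: zero_le_mult_iff)
    then show ?thesis by (simp add: A_def B_def C_def)
  qed
qed

section \<open>Rules for conditional moments: affine images, tower property, limits\<close>

lemma (in finite_measure_subalgebra) real_cond_exp_affine:
  assumes f: "integrable M f"
    and E: "AE x in M. real_cond_exp M F f x = L x"
  shows "AE x in M. real_cond_exp M F (\<lambda>x. a * f x + b) x = a * L x + b"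
proof -
  have "AE x in M. real_cond_exp M F (\<lambda>x. b) x = b" by (rule real_cond_exp_F_meas) auto
  moreover have "AE x in M. real_cond_exp M F (\<lambda>x. a * f x + b) x
      = real_cond_exp M F (\<lambda>x. a * f x) x + real_cond_exp M F (\<lambda>x. b) x"
    by (rule real_cond_exp_add) (use f in auto)
  ultimately show ?thesis using E real_cond_exp_cmult[OF f, of a] by eventually_elim simp
qed

text \<open>The shift cancels and the scaling enters squared. Since \<open>L\<close> is measurable
  for \<open>F\<close>, it can be pulled out of the mixed term, which leaves the second moment minus
  the squared mean. The rule exchanges conditional variances for second moments in both
  directions.\<close>

lemma (in finite_measure_subalgebra) cond_var_affine:
  assumes [measurable]: "f \<in> borel_measurable M" "L \<in> borel_measurable F"
    and f2: "integrable M (\<lambda>x. (f x)\<^sup>2)" and L2: "integrable M (\<lambda>x. (L x)\<^sup>2)"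
    and E1: "AE x in M. real_cond_exp M F f x = L x"
  shows "AE x in M. cond_var M F (\<lambda>x. a * f x + b) x
    = a\<^sup>2 * (real_cond_exp M F (\<lambda>x. (f x)\<^sup>2) x - (L x)\<^sup>2)"
proof -
  have [measurable]: "L \<in> borel_measurable M" by (rule measurable_from_subalg[OF subalg]) fact
  have f: "integrable M f" by (rule square_integrable_imp_integrable) fact+
  have fL: "integrable M (\<lambda>x. L x * f x)" by (rule integrable_mult_of_squares) fact+
  let ?g = "\<lambda>x. (f x)\<^sup>2 - 2 * (L x * f x) + (L x)\<^sup>2"
  have "AE x in M. (a * f x + b - real_cond_exp M F (\<lambda>x. a * f x + b) x)\<^sup>2 = a\<^sup>2 * ?g x"
    using real_cond_exp_affine[OF f E1, of a b]
    by eventually_elim (simp add: power2_eq_square algebra_simps)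
  then have "AE x in M. cond_var M F (\<lambda>x. a * f x + b) x = real_cond_exp M F (\<lambda>x. a\<^sup>2 * ?g x) x"
    unfolding cond_var_def by (intro real_cond_exp_cong) auto
  moreover have "AE x in M. real_cond_exp M F (\<lambda>x. a\<^sup>2 * ?g x) x = a\<^sup>2 * real_cond_exp M F ?g x"
    by (rule real_cond_exp_cmult) (use f2 L2 fL in auto)
  moreover have "AE x in M. real_cond_exp M F ?g x =
      real_cond_exp M F (\<lambda>x. (f x)\<^sup>2 - 2 * (L x * f x)) x + real_cond_exp M F (\<lambda>x. (L x)\<^sup>2) x"
    by (rule real_cond_exp_add) (use f2 L2 fL in auto)
  moreover have "AE x in M. real_cond_exp M F (\<lambda>x. (f x)\<^sup>2 - 2 * (L x * f x)) x =
      real_cond_exp M F (\<lambda>x. (f x)\<^sup>2) x - real_cond_exp M F (\<lambda>x. 2 * (L x * f x)) x"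
    by (rule real_cond_exp_diff) (use f2 L2 fL in auto)
  moreover have "AE x in M. real_cond_exp M F (\<lambda>x. 2 * (L x * f x)) x
      = 2 * real_cond_exp M F (\<lambda>x. L x * f x) x"
    by (rule real_cond_exp_cmult) fact
  moreover have "AE x in M. real_cond_exp M F (\<lambda>x. L x * f x) x = L x * real_cond_exp M F f x"
    by (rule real_cond_exp_mult) (use fL in auto)
  moreover have "AE x in M. real_cond_exp M F (\<lambda>x. (L x)\<^sup>2) x = (L x)\<^sup>2"
    by (rule real_cond_exp_F_meas) (use L2 in auto)
  ultimately show ?thesis using E1
  proof eventually_elim
    case (elim x)
    show ?case
      unfolding elim(1-7) by (simp add: elim(8) power2_eq_square algebra_simps)
  qed
qed

lemma (in finite_measure_subalgebra) cond_var_cong: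
  assumes eq: "AE x in M. f x = g x"
    and [measurable]: "f \<in> borel_measurable M" "g \<in> borel_measurable M"
  shows "AE x in M. cond_var M F f x = cond_var M F g x"
  unfolding cond_var_def
proof (rule real_cond_exp_cong)
  show "AE x in M. (f x - real_cond_exp M F f x)\<^sup>2 = (g x - real_cond_exp M F g x)\<^sup>2"
    using eq real_cond_exp_cong[OF eq assms(2,3)] by eventually_elim simp
qed measurable

text \<open>Tower property: a version that is already measurable for the smaller sigma-algebra
  survives the coarsening. This leads from the full past and future to finitely many conditioning
  times.\<close>

lemma (in finite_measure_subalgebra) real_cond_exp_coarsen:
  assumes sub: "subalgebra F G" and f: "integrable M f" and h: "integrable M h"
    and hG: "h \<in> borel_measurable G"
    and E: "AE x in M. real_cond_exp M F f x = h x"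
  shows "AE x in M. real_cond_exp M G f x = h x"
proof -
  have "subalgebra M G" using subalg sub by (auto simp: subalgebra_def)
  then interpret G: finite_measure_subalgebra M G by unfold_locales
  have "AE x in M. real_cond_exp M G (real_cond_exp M F f) x = real_cond_exp M G f x"
    by (rule G.real_cond_exp_nested_subalg[OF subalg sub f])
  moreover have "AE x in M. real_cond_exp M G (real_cond_exp M F f) x = real_cond_exp M G h x"
    by (rule G.real_cond_exp_cong[OF E]) (use h in auto)
  moreover have "AE x in M. real_cond_exp M G h x = h x"
    by (rule G.real_cond_exp_F_meas[OF h hG])
  ultimately show ?thesis by eventually_elim simp
qed

text \<open>Borel-Cantelli: deviations beyond 1/(n+1) with probabilities below 2^-n occur only
  finitely often. The predicates \<open>P n\<close> prescribe where the selected times lie, so that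
  the times themselves can be made to converge and to stay on one side of a given time.\<close>

lemma (in prob_space) tendsto_in_prob_AE_sequence:
  assumes lim: "tendsto_in_prob M X c G"
    and X: "\<And>n t. P n t \<Longrightarrow> X t \<in> borel_measurable M"
    and P: "\<And>n::nat. eventually (P n) G"
    and G: "G \<noteq> bot"
  obtains s where "\<And>n. P n (s n)" "AE \<omega> in M. (\<lambda>n. X (s n) \<omega>) \<longlonglongrightarrow> c"
proof -
  define e where "e n = inverse (real (Suc n))" for n
  have "\<exists>t. P n t \<and> measure M {\<omega> \<in> space M. \<bar>X t \<omega> - c\<bar> > e n} < (1/2) ^ n" for n
  proof -
    have "((\<lambda>t. measure M {\<omega> \<in> space M. \<bar>X t \<omega> - c\<bar> > e n}) \<longlongrightarrow> 0) G"
      using lim unfolding tendsto_in_prob_def e_def by simp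
    then have "eventually (\<lambda>t. measure M {\<omega> \<in> space M. \<bar>X t \<omega> - c\<bar> > e n} < (1/2) ^ n) G"
      by (rule order_tendstoD) simp
    with P[of n] have "eventually (\<lambda>t. P n t \<and>
        measure M {\<omega> \<in> space M. \<bar>X t \<omega> - c\<bar> > e n} < (1/2) ^ n) G" by eventually_elim simp
    then show ?thesis using G eventually_happens' by blast
  qed
  then obtain s where s: "\<And>n. P n (s n)"
    and m: "\<And>n. measure M {\<omega> \<in> space M. \<bar>X (s n) \<omega> - c\<bar> > e n} < (1/2) ^ n" by metis
  have [measurable]: "X (s n) \<in> borel_measurable M" for n using X s by blast
  have "AE \<omega> in M. eventually (\<lambda>n. \<omega> \<in> space M - {\<omega> \<in> space M. \<bar>X (s n) \<omega> - c\<bar> > e n}) sequentially"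
  proof (rule borel_cantelli_AE1)
    show "summable (\<lambda>n. measure M {\<omega> \<in> space M. \<bar>X (s n) \<omega> - c\<bar> > e n})"
      by (rule summable_comparison_test'[OF summable_geometric[of "1/2::real"], of 0])
        (use m in \<open>auto intro: less_imp_le\<close>)
  qed (auto simp: emeasure_eq_measure)
  then have "AE \<omega> in M. (\<lambda>n. X (s n) \<omega>) \<longlonglongrightarrow> c"
  proof eventually_elim
    case (elim \<omega>)
    have "(\<lambda>n. X (s n) \<omega> - c) \<longlonglongrightarrow> 0"
    proof (rule Lim_null_comparison)
      show "e \<longlonglongrightarrow> 0" unfolding e_def by (rule LIMSEQ_inverse_real_of_nat)
      show "eventually (\<lambda>n. norm (X (s n) \<omega> - c) \<le> e n) sequentially"
        using elim by eventually_elim auto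
    qed
    then show ?case by (simp add: LIM_zero_iff)
  qed
  with s show ?thesis by (rule that)
qed

text \<open>The functions \<open>h n\<close> need not be dominated. On the event \<open>B n\<close>
  they are bounded by |c| + 1, and \<open>B n\<close> belongs to \<open>G n\<close>, so the defining
  identity of the conditional expectation holds on it. Almost every point lies in \<open>B n\<close>
  eventually, and dominated convergence applies to both sides.\<close>

lemma (in prob_space) expectation_eq_limit_cond_exp:
  fixes f :: "'a \<Rightarrow> real" and h :: "nat \<Rightarrow> 'a \<Rightarrow> real"
  assumes sub: "\<And>n. subalgebra M (G n)" and hm: "\<And>n. h n \<in> borel_measurable (G n)"
    and f: "integrable M f"
    and E: "\<And>n. AE \<omega> in M. real_cond_exp M (G n) f \<omega> = h n \<omega>"
    and lim: "AE \<omega> in M. (\<lambda>n. h n \<omega>) \<longlonglongrightarrow> c"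
  shows "(\<integral>\<omega>. f \<omega> \<partial>M) = c"
proof -
  define B where "B n = {\<omega> \<in> space M. \<bar>h n \<omega> - c\<bar> \<le> 1}" for n
  have hM [measurable]: "h n \<in> borel_measurable M" for n
    using measurable_from_subalg[OF sub hm] .
  have [measurable]: "f \<in> borel_measurable M" using f by auto
  have BG: "B n \<in> sets (G n)" for n
  proof -
    have "space (G n) = space M" using sub[of n] by (simp add: subalgebra_def)
    moreover have [measurable]: "h n \<in> borel_measurable (G n)" by (rule hm)
    have "{\<omega> \<in> space (G n). \<bar>h n \<omega> - c\<bar> \<le> 1} \<in> sets (G n)" by measurable
    ultimately show ?thesis by (simp add: B_def)
  qed
  have [measurable]: "B n \<in> sets M" for n unfolding B_def by measurable
  have ev: "AE \<omega> in M. eventually (\<lambda>n. indicator (B n) \<omega> = (1::real)) sequentially"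
    using lim AE_space
  proof eventually_elim
    case (elim \<omega>)
    have "eventually (\<lambda>n. dist (h n \<omega>) c < 1) sequentially"
      using elim(1) by (rule tendstoD) simp
    then show ?case
    proof eventually_elim
      case (elim n)
      then show ?case using \<open>\<omega> \<in> space M\<close> by (auto simp: B_def dist_real_def)
    qed
  qed
  have eq: "(\<integral>\<omega>. indicator (B n) \<omega> * f \<omega> \<partial>M) = (\<integral>\<omega>. indicator (B n) \<omega> * h n \<omega> \<partial>M)" for n
  proof -
    interpret n: finite_measure_subalgebra M "G n" by unfold_locales (rule sub)
    have "(\<integral>\<omega>\<in>B n. f \<omega> \<partial>M) = (\<integral>\<omega>\<in>B n. real_cond_exp M (G n) f \<omega> \<partial>M)"
      by (rule n.real_cond_exp_intA[OF f BG])
    also have "\<dots> = (\<integral>\<omega>\<in>B n. h n \<omega> \<partial>M)"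
      unfolding set_lebesgue_integral_def by (intro integral_cong_AE) (use E[of n] in auto)
    finally show ?thesis by (simp add: set_lebesgue_integral_def)
  qed
  have "(\<lambda>n. \<integral>\<omega>. indicator (B n) \<omega> * f \<omega> \<partial>M) \<longlonglongrightarrow> (\<integral>\<omega>. f \<omega> \<partial>M)"
  proof (rule integral_dominated_convergence[where w = "\<lambda>\<omega>. \<bar>f \<omega>\<bar>"])
    show "AE \<omega> in M. (\<lambda>n. indicator (B n) \<omega> * f \<omega>) \<longlonglongrightarrow> f \<omega>"
      using ev by eventually_elim (rule tendsto_eventually, auto elim: eventually_mono)
  qed (use f in \<open>auto simp: indicator_def\<close>)
  moreover have "(\<lambda>n. \<integral>\<omega>. indicator (B n) \<omega> * h n \<omega> \<partial>M) \<longlonglongrightarrow> (\<integral>\<omega>. c \<partial>M)"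
  proof (rule integral_dominated_convergence[where w = "\<lambda>\<omega>. \<bar>c\<bar> + 1"])
    show "AE \<omega> in M. (\<lambda>n. indicator (B n) \<omega> * h n \<omega>) \<longlonglongrightarrow> c"
      using ev lim
    proof eventually_elim
      case (elim \<omega>)
      then have "eventually (\<lambda>n. h n \<omega> = indicator (B n) \<omega> * h n \<omega>) sequentially"
        by (auto elim: eventually_mono)
      then show ?case by (rule Lim_transform_eventually[OF elim(2)])
    qed
  qed (auto simp: indicator_def B_def)
  ultimately have "(\<integral>\<omega>. f \<omega> \<partial>M) = (\<integral>\<omega>. c \<partial>M)"
    unfolding eq by (rule LIMSEQ_unique)
  then show ?thesis by (simp add: prob_space)
qed

text \<open>The same truncation bounds the integral of \<open>f\<close> over \<open>B n\<close> by
  |c| + 1 for every n. The events \<open>B n\<close> need not increase, so Fatou's lemma takes the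
  place of monotone convergence. Nonnegative conditional expectations are used throughout, as
  integrability is the goal.\<close>

lemma (in prob_space) integrable_limit_cond_exp:
  fixes f :: "'a \<Rightarrow> real" and h :: "nat \<Rightarrow> 'a \<Rightarrow> real"
  assumes sub: "\<And>n. subalgebra M (G n)" and hm: "\<And>n. h n \<in> borel_measurable (G n)"
    and fm [measurable]: "f \<in> borel_measurable M" and f0: "\<And>\<omega>. 0 \<le> f \<omega>"
    and E: "\<And>n. ext_cond_exp_eq M (G n) f (h n)"
    and lim: "AE \<omega> in M. (\<lambda>n. h n \<omega>) \<longlonglongrightarrow> c"
  shows "integrable M f"
proof -
  define B where "B n = {\<omega> \<in> space M. \<bar>h n \<omega> - c\<bar> \<le> 1}" for n
  have hM [measurable]: "h n \<in> borel_measurable M" for n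
    using measurable_from_subalg[OF sub hm] .
  have BG: "B n \<in> sets (G n)" for n
  proof -
    have "space (G n) = space M" using sub[of n] by (simp add: subalgebra_def)
    moreover have [measurable]: "h n \<in> borel_measurable (G n)" by (rule hm)
    have "{\<omega> \<in> space (G n). \<bar>h n \<omega> - c\<bar> \<le> 1} \<in> sets (G n)" by measurable
    ultimately show ?thesis by (simp add: B_def)
  qed
  have [measurable]: "B n \<in> sets M" for n unfolding B_def by measurable
  have bound: "(\<integral>\<^sup>+\<omega>. indicator (B n) \<omega> * ennreal (f \<omega>) \<partial>M) \<le> ennreal (\<bar>c\<bar> + 1)" for n
  proof -
    interpret n: finite_measure_subalgebra M "G n" by unfold_locales (rule sub)
    \<comment> \<open>With a vanishing negative part, the real conditional expectation is
      \<open>enn2real\<close> of the nonnegative one. The finiteness clause is essential to invert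
      this, because \<open>enn2real\<close> sends infinity to 0.\<close>
    have neg: "(\<lambda>\<omega>. ennreal (- f \<omega>)) = (\<lambda>\<omega>. 0)" using f0 by (auto simp: ennreal_neg)
    have "AE \<omega> in M. nn_cond_exp M (G n) (\<lambda>\<omega>. 0) \<omega> = 0"
      using n.nn_cond_exp_F_meas[of "\<lambda>\<omega>. 0"] by auto
    with E[of n] have "AE \<omega> in M. nn_cond_exp M (G n) (\<lambda>\<omega>. ennreal (f \<omega>)) \<omega> = ennreal (h n \<omega>)"
      unfolding ext_cond_exp_eq_def real_cond_exp_def neg
    proof eventually_elim
      case (elim \<omega>)
      then have "nn_cond_exp M (G n) (\<lambda>\<omega>. ennreal (f \<omega>)) \<omega> < top"
        "enn2real (nn_cond_exp M (G n) (\<lambda>\<omega>. ennreal (f \<omega>)) \<omega>) = h n \<omega>"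
        by simp_all
      then show ?case by (metis ennreal_enn2real)
    qed
    then have *: "AE \<omega> in M. indicator (B n) \<omega> * nn_cond_exp M (G n) (\<lambda>\<omega>. ennreal (f \<omega>)) \<omega>
        \<le> ennreal (\<bar>c\<bar> + 1)"
    proof eventually_elim
      case (elim \<omega>)
      show ?case
      proof (cases "\<omega> \<in> B n")
        case True
        then have "h n \<omega> \<le> \<bar>c\<bar> + 1" by (auto simp: B_def)
        then have "ennreal (h n \<omega>) \<le> ennreal (\<bar>c\<bar> + 1)" by (rule ennreal_leI)
        with True elim show ?thesis by (simp del: ennreal_plus)
      qed simp
    qed
    have "(\<integral>\<^sup>+\<omega>. indicator (B n) \<omega> * ennreal (f \<omega>) \<partial>M)
        = (\<integral>\<^sup>+\<omega>. indicator (B n) \<omega> * nn_cond_exp M (G n) (\<lambda>\<omega>. ennreal (f \<omega>)) \<omega> \<partial>M)"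
      by (rule n.nn_cond_exp_intg[symmetric]) (use BG in simp_all)
    also have "\<dots> \<le> (\<integral>\<^sup>+\<omega>. ennreal (\<bar>c\<bar> + 1) \<partial>M)" by (rule nn_integral_mono_AE[OF *])
    finally show ?thesis by (simp add: emeasure_space_1 del: ennreal_plus)
  qed
  have "AE \<omega> in M. ennreal (f \<omega>) \<le> liminf (\<lambda>n. indicator (B n) \<omega> * ennreal (f \<omega>))"
    using lim AE_space
  proof eventually_elim
    case (elim \<omega>)
    have "eventually (\<lambda>n. dist (h n \<omega>) c < 1) sequentially"
      using elim(1) by (rule tendstoD) simp
    then have "eventually (\<lambda>n. ennreal (f \<omega>) \<le> indicator (B n) \<omega> * ennreal (f \<omega>)) sequentially"
    proof eventually_elim
      case (elim n)
      then show ?case using \<open>\<omega> \<in> space M\<close> by (auto simp: B_def dist_real_def)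
    qed
    then show ?case by (rule Liminf_bounded)
  qed
  then have "(\<integral>\<^sup>+\<omega>. ennreal (f \<omega>) \<partial>M)
      \<le> (\<integral>\<^sup>+\<omega>. liminf (\<lambda>n. indicator (B n) \<omega> * ennreal (f \<omega>)) \<partial>M)"
    by (rule nn_integral_mono_AE)
  also have "\<dots> \<le> liminf (\<lambda>n. \<integral>\<^sup>+\<omega>. indicator (B n) \<omega> * ennreal (f \<omega>) \<partial>M)"
    by (rule nn_integral_liminf) auto
  also have "\<dots> \<le> ennreal (\<bar>c\<bar> + 1)"
    by (rule Liminf_le) (use bound in \<open>simp_all del: ennreal_plus\<close>)
  finally have "(\<integral>\<^sup>+\<omega>. ennreal (f \<omega>) \<partial>M) < \<infinity>" by (rule order_le_less_trans) (simp del: ennreal_plus)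
  then show ?thesis using f0 by (intro integrableI_nonneg) auto
qed

section \<open>Conditional moments of a Meixner process\<close>

text \<open>The height at time t of the chord through (s, a) and (u, b), which is the conditional
  mean of a harness.\<close>

definition interp :: "real \<Rightarrow> real \<Rightarrow> real \<Rightarrow> real \<Rightarrow> real \<Rightarrow> real" where
  "interp s t u a b = (u - t) / (u - s) * a + (t - s) / (u - s) * b"

text \<open>The non-random factor of the conditional variance; for \<tau> = 0 it is the variance at
  time t of a Brownian bridge over [s, u].\<close>

definition meixner_scale :: "real \<Rightarrow> real \<Rightarrow> real \<Rightarrow> real \<Rightarrow> real" where
  "meixner_scale \<tau> s t u = (t - s) * (u - t) / (u - s + \<tau>)"

definition meixner_form :: "real \<Rightarrow> real \<Rightarrow> real \<Rightarrow> real \<Rightarrow> real \<Rightarrow> real \<Rightarrow> real" where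
  "meixner_form \<theta> \<tau> s u a b = 1 + \<theta> * ((b - a) / (u - s)) + \<tau> * ((b - a) / (u - s))\<^sup>2"

text \<open>A raw moment, because squaring is a fixed function of the value at t, as the bridge
  property demands; the variance would involve centring at a random conditional mean.\<close>

definition meixner_moment2 ::
    "real \<Rightarrow> real \<Rightarrow> real \<Rightarrow> real \<Rightarrow> real \<Rightarrow> real \<Rightarrow> real \<Rightarrow> real" where
  "meixner_moment2 \<theta> \<tau> s t u a b =
     (interp s t u a b)\<^sup>2 + meixner_scale \<tau> s t u * meixner_form \<theta> \<tau> s u a b"

lemma (in prob_space) integrable_interp:
  assumes [measurable]: "f \<in> borel_measurable M" "g \<in> borel_measurable M"
    and sq: "integrable M (\<lambda>\<omega>. (f \<omega>)\<^sup>2)" "integrable M (\<lambda>\<omega>. (g \<omega>)\<^sup>2)"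
  shows "integrable M (\<lambda>\<omega>. interp s t u (f \<omega>) (g \<omega>))"
    and "integrable M (\<lambda>\<omega>. (interp s t u (f \<omega>) (g \<omega>))\<^sup>2)"
    and "integrable M (\<lambda>\<omega>. meixner_form \<theta> \<tau> s u (f \<omega>) (g \<omega>))"
    and "integrable M (\<lambda>\<omega>. meixner_moment2 \<theta> \<tau> s t u (f \<omega>) (g \<omega>))"
proof -
  have i: "integrable M f" "integrable M g"
    by (rule square_integrable_imp_integrable; fact)+
  show 1: "integrable M (\<lambda>\<omega>. interp s t u (f \<omega>) (g \<omega>))"
    unfolding interp_def using i by simp
  show 2: "integrable M (\<lambda>\<omega>. (interp s t u (f \<omega>) (g \<omega>))\<^sup>2)"
    unfolding interp_def by (rule integrable_square_lincomb) (use sq in simp_all)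
  have "integrable M (\<lambda>\<omega>. ((g \<omega> - f \<omega>) / (u - s))\<^sup>2)"
    using integrable_square_lincomb[OF assms(2,1) sq(2,1), of "1 / (u - s)" "- 1 / (u - s)"]
    by (simp add: diff_divide_distrib)
  then show 3: "integrable M (\<lambda>\<omega>. meixner_form \<theta> \<tau> s u (f \<omega>) (g \<omega>))"
    unfolding meixner_form_def using i by simp
  show "integrable M (\<lambda>\<omega>. meixner_moment2 \<theta> \<tau> s t u (f \<omega>) (g \<omega>))"
    unfolding meixner_moment2_def using 2 3 by simp
qed

lemma borel_measurable_interp [measurable (raw)]:
  assumes [measurable]: "f \<in> borel_measurable M" "g \<in> borel_measurable M"
  shows "(\<lambda>x. interp s t u (f x) (g x)) \<in> borel_measurable M"
  unfolding interp_def by measurable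

lemma borel_measurable_meixner_moment2 [measurable (raw)]:
  assumes [measurable]: "f \<in> borel_measurable M" "g \<in> borel_measurable M"
  shows "(\<lambda>x. meixner_moment2 \<theta> \<tau> s t u (f x) (g x)) \<in> borel_measurable M"
  unfolding meixner_moment2_def meixner_form_def by measurable

text \<open>Taking expectations in the formula for the conditional variance identifies the
  non-random factor as \<^term>\<open>meixner_scale \<tau> s t u\<close>.\<close>

lemma (in prob_space) QH_Meixner_cond_moment2:
  assumes QH: "QH M {0<..} Z 0 \<theta> 0 \<tau> 1" and \<tau>: "0 \<le> \<tau>"
    and st: "0 < s" "s < t" "t < u"
  shows "AE \<omega> in M. real_cond_exp M (past_future M {0<..} Z s u) (\<lambda>\<omega>. (Z t \<omega>)\<^sup>2) \<omega>
    = meixner_moment2 \<theta> \<tau> s t u (Z s \<omega>) (Z u \<omega>)"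
proof -
  have pos: "0 < t" "0 < u" using st by auto
  have m: "Z x \<in> borel_measurable M" and sq: "integrable M (\<lambda>\<omega>. (Z x \<omega>)\<^sup>2)"
    and mean: "(\<integral>\<omega>. Z x \<omega> \<partial>M) = 0" if "0 < x" for x
    using QH that unfolding QH_def by auto
  have cov: "(\<integral>\<omega>. Z x \<omega> * Z y \<omega> \<partial>M) = min x y" if "0 < x" "0 < y" for x y
    using QH that unfolding QH_def by auto
  note [measurable] = m[OF st(1)] m[OF pos(1)] m[OF pos(2)]
  have int: "integrable M (Z x)" if "0 < x" for x
    using square_integrable_imp_integrable[OF m sq] that by blast
  let ?F = "past_future M {0<..} Z s u"
  interpret F: finite_measure_subalgebra M ?F
    unfolding past_future_def by (rule finite_measure_subalgebra_sigma_of) (use m in auto)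
  have mF [measurable]: "Z s \<in> borel_measurable ?F" "Z u \<in> borel_measurable ?F"
    unfolding past_future_def using st by (auto intro!: measurable_sigma_of)
  let ?L = "\<lambda>\<omega>. interp s t u (Z s \<omega>) (Z u \<omega>)"
  let ?q = "\<lambda>\<omega>. meixner_form \<theta> \<tau> s u (Z s \<omega>) (Z u \<omega>)"
  note L = integrable_interp[OF m[OF st(1)] m[OF pos(2)] sq[OF st(1)] sq[OF pos(2)]]
  have E1: "AE \<omega> in M. real_cond_exp M ?F (Z t) \<omega> = ?L \<omega>"
    using QH st pos unfolding QH_def interp_def by auto
  obtain c where c: "AE \<omega> in M. cond_var M ?F (Z t) \<omega> = c * ?q \<omega>"
  proof -
    note QH[unfolded QH_def, THEN conjunct2, THEN conjunct2, THEN conjunct2, THEN conjunct2,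
        THEN conjunct2, THEN conjunct2, THEN conjunct2, THEN conjunct2]
    then obtain c where "\<forall>s\<in>{0<..}. \<forall>t\<in>{0<..}. \<forall>u\<in>{0<..}. s < t \<longrightarrow> t < u \<longrightarrow>
        (AE \<omega> in M. cond_var M (past_future M {0<..} Z s u) (Z t) \<omega> = c t s u *
             (1 + 0 * ((u * Z s \<omega> - s * Z u \<omega>) / (u - s))
                + \<theta> * ((Z u \<omega> - Z s \<omega>) / (u - s))
                + 0 * ((u * Z s \<omega> - s * Z u \<omega>)\<^sup>2 / (u - s)\<^sup>2)
                + \<tau> * ((Z u \<omega> - Z s \<omega>)\<^sup>2 / (u - s)\<^sup>2)
                - (1 - 1) * ((Z u \<omega> - Z s \<omega>) * (u * Z s \<omega> - s * Z u \<omega>) / (u - s)\<^sup>2)))"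
      by (rule exE)
    then have "AE \<omega> in M. cond_var M ?F (Z t) \<omega> = c t s u * ?q \<omega>"
      using st pos by (simp add: meixner_form_def power_divide)
    then show ?thesis by (rule that)
  qed
  \<comment> \<open>The identity map is written as an affine one in order to trade the conditional
    variance for the second moment.\<close>
  have "AE \<omega> in M. cond_var M ?F (\<lambda>\<omega>. 1 * Z t \<omega> + 0) \<omega> =
      1\<^sup>2 * (real_cond_exp M ?F (\<lambda>\<omega>. (Z t \<omega>)\<^sup>2) \<omega> - (?L \<omega>)\<^sup>2)"
    by (rule F.cond_var_affine) (use E1 sq pos L in simp_all)
  with c have E2: "AE \<omega> in M. real_cond_exp M ?F (\<lambda>\<omega>. (Z t \<omega>)\<^sup>2) \<omega> = (?L \<omega>)\<^sup>2 + c * ?q \<omega>"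
    by eventually_elim simp
  have prods: "integrable M (\<lambda>\<omega>. Z s \<omega> * Z u \<omega>)"
    by (rule integrable_mult_of_squares) (use m sq st pos in auto)
  have sq_eq: "(\<integral>\<omega>. (Z x \<omega>)\<^sup>2 \<partial>M) = x" if "0 < x" for x
    using cov[OF that that] by (simp add: power2_eq_square)
  have EL: "(\<integral>\<omega>. (?L \<omega>)\<^sup>2 \<partial>M) = ((u - t)\<^sup>2 * s + (t - s)\<^sup>2 * u + 2 * (u - t) * (t - s) * s) / (u - s)\<^sup>2"
  proof -
    define a b where "a = (u - t) / (u - s)" and "b = (t - s) / (u - s)"
    have "(\<integral>\<omega>. (?L \<omega>)\<^sup>2 \<partial>M) =
        (\<integral>\<omega>. a\<^sup>2 * (Z s \<omega>)\<^sup>2 + b\<^sup>2 * (Z u \<omega>)\<^sup>2 + 2 * a * b * (Z s \<omega> * Z u \<omega>) \<partial>M)"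
      unfolding interp_def a_def[symmetric] b_def[symmetric]
      by (simp add: power2_eq_square algebra_simps)
    also have "\<dots> = a\<^sup>2 * s + b\<^sup>2 * u + 2 * a * b * s"
      using sq prods sq_eq cov[of s u] st pos by simp
    also have "\<dots> = ((u - t)\<^sup>2 * s + (t - s)\<^sup>2 * u + 2 * (u - t) * (t - s) * s) / (u - s)\<^sup>2"
      unfolding a_def b_def by (simp add: power_divide add_divide_distrib power2_eq_square)
    finally show ?thesis .
  qed
  have Eq: "(\<integral>\<omega>. ?q \<omega> \<partial>M) = 1 + \<tau> / (u - s)"
  proof -
    define d where "d = u - s"
    have "(\<integral>\<omega>. ?q \<omega> \<partial>M) = (\<integral>\<omega>. 1 + \<theta> / d * (Z u \<omega> - Z s \<omega>)
        + \<tau> / d\<^sup>2 * ((Z u \<omega>)\<^sup>2 + (Z s \<omega>)\<^sup>2 - 2 * (Z s \<omega> * Z u \<omega>)) \<partial>M)"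
      unfolding meixner_form_def d_def[symmetric]
      by (intro Bochner_Integration.integral_cong refl)
        (simp add: power2_eq_square algebra_simps add_divide_distrib diff_divide_distrib)
    also have "\<dots> = 1 + \<theta> / d * (0 - 0) + \<tau> / d\<^sup>2 * (u + s - 2 * s)"
    proof -
      have "(\<integral>\<omega>. Z s \<omega> * Z u \<omega> \<partial>M) = s" using cov[of s u] st pos by simp
      then have "has_bochner_integral M (\<lambda>\<omega>. Z s \<omega> * Z u \<omega>) s"
        using prods by (simp only: has_bochner_integral_iff simp_thms)
      moreover have "has_bochner_integral M (\<lambda>\<omega>. (Z x \<omega>)\<^sup>2) x" "has_bochner_integral M (Z x) 0"
        if "0 < x" for x
        using sq[OF that] sq_eq[OF that] int[OF that] mean[OF that]
        by (simp_all only: has_bochner_integral_iff simp_thms)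
      moreover have "has_bochner_integral M (\<lambda>\<omega>. 1::real) 1"
        by (simp add: has_bochner_integral_iff prob_space)
      ultimately show ?thesis
        by (intro has_bochner_integral_integral_eq has_bochner_integral_add
            has_bochner_integral_diff has_bochner_integral_mult_right) (simp_all add: st pos)
    qed
    also have "u + s - 2 * s = d" by (simp add: d_def)
    also have "1 + \<theta> / d * (0 - 0) + \<tau> / d\<^sup>2 * d = 1 + \<tau> / (u - s)"
      using st by (simp add: power2_eq_square flip: d_def)
    finally show ?thesis .
  qed
  have "t = (\<integral>\<omega>. real_cond_exp M ?F (\<lambda>\<omega>. (Z t \<omega>)\<^sup>2) \<omega> \<partial>M)"
    using F.real_cond_exp_int(2)[OF sq[OF pos(1)]] sq_eq[OF pos(1)] by simp
  also have "\<dots> = (\<integral>\<omega>. (?L \<omega>)\<^sup>2 + c * ?q \<omega> \<partial>M)"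
    by (rule integral_cong_AE) (use E2 L in auto)
  also have "\<dots> = (\<integral>\<omega>. (?L \<omega>)\<^sup>2 \<partial>M) + c * (1 + \<tau> / (u - s))"
    unfolding Eq[symmetric] using L by simp
  finally have "c * (1 + \<tau> / (u - s)) = t - (\<integral>\<omega>. (?L \<omega>)\<^sup>2 \<partial>M)" by simp
  \<comment> \<open>The squared chord has expectation s + (t - s)^2/(u - s), so the Brownian bridge
    variance remains. The mean 1 + \<tau>/(u - s) of the quadratic form then turns the denominator
    into u - s + \<tau>.\<close>
  also have "\<dots> = (t - s) * (u - t) / (u - s)"
  proof -
    define d where "d = u - s"
    have "(u - t)\<^sup>2 * s + (t - s)\<^sup>2 * u + 2 * (u - t) * (t - s) * s = s * d\<^sup>2 + (t - s)\<^sup>2 * d"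
      unfolding d_def by algebra
    moreover have "d \<noteq> 0" "u - t = d - (t - s)" using st by (simp_all add: d_def)
    ultimately show ?thesis
      unfolding EL d_def[symmetric] by (simp add: field_simps power2_eq_square)
  qed
  finally have c_eq: "c * (1 + \<tau> / (u - s)) = (t - s) * (u - t) / (u - s)" .
  have "c = meixner_scale \<tau> s t u"
  proof -
    define d where "d = u - s"
    have "0 < d" using st by (simp add: d_def)
    then have "c * (d + \<tau>) = (t - s) * (u - t)"
      using c_eq unfolding d_def[symmetric] by (simp add: field_simps)
    then show ?thesis
      unfolding meixner_scale_def d_def[symmetric] using \<open>0 < d\<close> \<tau> by (simp add: eq_divide_eq)
  qed
  with E2 show ?thesis unfolding meixner_moment2_def by simp
qed

text \<open>Both conditional moments are functions of the values at s and u alone, so they persist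
  for any smaller conditioning set that still contains these two times.\<close>

lemma (in prob_space) QH_Meixner_cond_moments:
  assumes QH: "QH M {0<..} Z 0 \<theta> 0 \<tau> 1" and \<tau>: "0 \<le> \<tau>"
    and st: "0 < s" "s < t" "t < u"
    and K: "s \<in> K" "u \<in> K" "\<And>x. x \<in> K \<Longrightarrow> 0 < x \<and> (x \<le> s \<or> u \<le> x)"
  shows "AE \<omega> in M. real_cond_exp M (sigma_of M Z K) (Z t) \<omega> = interp s t u (Z s \<omega>) (Z u \<omega>)"
    and "AE \<omega> in M. real_cond_exp M (sigma_of M Z K) (\<lambda>\<omega>. (Z t \<omega>)\<^sup>2) \<omega>
      = meixner_moment2 \<theta> \<tau> s t u (Z s \<omega>) (Z u \<omega>)"
proof -
  have pos: "0 < t" "0 < u" using st by auto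
  have m: "Z x \<in> borel_measurable M" and sq: "integrable M (\<lambda>\<omega>. (Z x \<omega>)\<^sup>2)"
    if "0 < x" for x
    using QH that unfolding QH_def by auto
  let ?F = "past_future M {0<..} Z s u"
  interpret F: finite_measure_subalgebra M ?F
    unfolding past_future_def by (rule finite_measure_subalgebra_sigma_of) (use m in auto)
  have sub: "subalgebra ?F (sigma_of M Z K)"
    unfolding past_future_def by (rule subalgebra_sigma_of_mono) (use K in auto)
  note mK = measurable_sigma_of[OF K(1), of Z M] measurable_sigma_of[OF K(2), of Z M]
  note L = integrable_interp[OF m[OF st(1)] m[OF pos(2)] sq[OF st(1)] sq[OF pos(2)]]
  have "AE \<omega> in M. real_cond_exp M ?F (Z t) \<omega> = interp s t u (Z s \<omega>) (Z u \<omega>)"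
    using QH st pos unfolding QH_def interp_def by auto
  then show "AE \<omega> in M. real_cond_exp M (sigma_of M Z K) (Z t) \<omega> = interp s t u (Z s \<omega>) (Z u \<omega>)"
    by (rule F.real_cond_exp_coarsen[OF sub square_integrable_imp_integrable[OF m[OF pos(1)] sq[OF pos(1)]]
          L(1) borel_measurable_interp[OF mK]])
  show "AE \<omega> in M. real_cond_exp M (sigma_of M Z K) (\<lambda>\<omega>. (Z t \<omega>)\<^sup>2) \<omega>
      = meixner_moment2 \<theta> \<tau> s t u (Z s \<omega>) (Z u \<omega>)"
    by (rule F.real_cond_exp_coarsen[OF sub sq[OF pos(1)] L(4)
          borel_measurable_meixner_moment2[OF mK] QH_Meixner_cond_moment2[OF QH \<tau> st]])
qed

text \<open>The bridge property for one intermediate time and a function \<open>h\<close> that reads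
  a single coordinate of the past tuple and a single coordinate of the future tuple; the samples are
  thereby replaced by plain process values.\<close>

lemma bridgeD_cond_exp:
  assumes "bridge N X r zr v zv M T Z"
    and "finite S" "finite U" "S \<subseteq> {r<..<v}" "t \<in> {r<..<v}" "U \<subseteq> {r<..<v}"
    and "\<forall>s\<in>S. s < t" "\<forall>u\<in>U. t < u" "s \<in> S" "u \<in> U"
    and g: "g \<in> borel_measurable borel"
    and h: "(\<lambda>(a, b). h a b) \<in> borel_measurable (borel \<Otimes>\<^sub>M borel)"
    and int: "integrable M (\<lambda>\<omega>. g (Z t \<omega>))"
    and E: "AE \<omega> in M. real_cond_exp M (sigma_of M Z (S \<union> U)) (\<lambda>\<omega>. g (Z t \<omega>)) \<omega> = h (Z s \<omega>) (Z u \<omega>)"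
  shows "ext_cond_exp_eq N (sigma_of N X (S \<union> U)) (\<lambda>\<omega>. g (X t \<omega>)) (\<lambda>\<omega>. h (X s \<omega>) (X u \<omega>))"
proof -
  let ?g = "\<lambda>x::real \<Rightarrow> real. g (x t)"
  let ?h = "\<lambda>p::(real \<Rightarrow> real) \<times> (real \<Rightarrow> real). h (fst p s) (snd p u)"
  have [measurable]: "(\<lambda>p. fst p s) \<in> borel_measurable ((\<Pi>\<^sub>M i\<in>S. borel) \<Otimes>\<^sub>M (\<Pi>\<^sub>M i\<in>U. borel))"
    "(\<lambda>p. snd p u) \<in> borel_measurable ((\<Pi>\<^sub>M i\<in>S. borel) \<Otimes>\<^sub>M (\<Pi>\<^sub>M i\<in>U. borel))"
    using assms(9,10)
    by (auto intro: measurable_compose[OF measurable_fst measurable_component_singleton]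
        measurable_compose[OF measurable_snd measurable_component_singleton])
  have "(\<lambda>p. (fst p s, snd p u)) \<in> ((\<Pi>\<^sub>M i\<in>S. borel) \<Otimes>\<^sub>M (\<Pi>\<^sub>M i\<in>U. borel)) \<rightarrow>\<^sub>M borel \<Otimes>\<^sub>M borel"
    by measurable
  from measurable_compose[OF this h]
  have hm: "?h \<in> borel_measurable ((\<Pi>\<^sub>M i\<in>S. borel) \<Otimes>\<^sub>M (\<Pi>\<^sub>M i\<in>U. borel))" by simp
  have gm: "?g \<in> borel_measurable (\<Pi>\<^sub>M i\<in>{t}. borel)"
    by (rule measurable_compose[OF measurable_component_singleton[of t "{t}" "\<lambda>_. borel"] g]) simp
  have sample: "sample W {t} \<omega> t = W t \<omega>" "sample W S \<omega> s = W s \<omega>" "sample W U \<omega> u = W u \<omega>"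
    for W :: "real \<Rightarrow> 'c \<Rightarrow> real" and \<omega>
    using assms(9,10) by (auto simp: sample_def)
  have int': "integrable M (\<lambda>\<omega>. ?g (sample Z {t} \<omega>))"
    using int by (simp only: sample)
  have E': "AE \<omega> in M. real_cond_exp M (sigma_of M Z (S \<union> U)) (\<lambda>\<omega>. ?g (sample Z {t} \<omega>)) \<omega>
      = ?h (sample Z S \<omega>, sample Z U \<omega>)"
    using E by (simp only: sample fst_conv snd_conv)
  have "ext_cond_exp_eq N (sigma_of N X (S \<union> U)) (\<lambda>\<omega>. ?g (sample X {t} \<omega>))
      (\<lambda>\<omega>. ?h (sample X S \<omega>, sample X U \<omega>))"
    by (rule assms(1)[unfolded bridge_def, THEN conjunct2, THEN conjunct2, THEN conjunct2,
          THEN conjunct2, THEN conjunct2, rule_format, OF gm hm])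
      (fact int' | fact E' | (use assms(2-10) in auto)[1])+
  then show ?thesis by (simp only: sample fst_conv snd_conv)
qed

section \<open>Moments of the bridge\<close>

locale meixner_bridge = M: prob_space M + N: prob_space N
  for M :: "'a measure" and N :: "'b measure" +
  fixes Z :: "real \<Rightarrow> 'a \<Rightarrow> real" and X :: "real \<Rightarrow> 'b \<Rightarrow> real"
    and \<tau> \<theta> r v zr zv :: real
  assumes tau_nonneg: "0 \<le> \<tau>"
    and QH_Z: "QH M {0<..} Z 0 \<theta> 0 \<tau> 1"
    and r_nonneg: "0 \<le> r" and r_less_v: "r < v"
    and bridge_X: "bridge N X r zr v zv M {0<..} Z"
begin

lemma measurable_X: "r < t \<Longrightarrow> t < v \<Longrightarrow> X t \<in> borel_measurable N"
  using bridge_X unfolding bridge_def by simp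

text \<open>No time of \<open>J\<close> lies strictly between s and u, so \<open>J\<close> splits
  into a past part containing s and a future part containing u, both nonempty as the bridge property
  requires. Integrability of \<open>X t\<close> is still open here, hence the extended
  sense.\<close>

lemma ext_cond_moments:
  assumes J: "finite J" "J \<subseteq> {r<..<v}" "s \<in> J" "u \<in> J" "\<And>x. x \<in> J \<Longrightarrow> x \<le> s \<or> u \<le> x"
    and st: "s < t" "t < u"
  shows "ext_cond_exp_eq N (sigma_of N X J) (X t) (\<lambda>\<omega>. interp s t u (X s \<omega>) (X u \<omega>))"
    and "ext_cond_exp_eq N (sigma_of N X J) (\<lambda>\<omega>. (X t \<omega>)\<^sup>2)
      (\<lambda>\<omega>. meixner_moment2 \<theta> \<tau> s t u (X s \<omega>) (X u \<omega>))"
proof -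
  have su: "r < s" "u < v" "0 < s" "0 < t" using J st r_nonneg by (auto dest: subsetD)
  have m: "Z t \<in> borel_measurable M" and sq: "integrable M (\<lambda>\<omega>. (Z t \<omega>)\<^sup>2)"
    using QH_Z su unfolding QH_def by auto
  define S U where "S = J \<inter> {..s}" and "U = J \<inter> {u..}"
  have SU: "finite S" "finite U" "S \<subseteq> {r<..<v}" "t \<in> {r<..<v}" "U \<subseteq> {r<..<v}"
    "\<forall>s\<in>S. s < t" "\<forall>u\<in>U. t < u" "s \<in> S" "u \<in> U"
    using J st su unfolding S_def U_def by auto
  have un: "S \<union> U = J" using J(5) unfolding S_def U_def by auto
  have K: "\<And>x. x \<in> J \<Longrightarrow> 0 < x \<and> (x \<le> s \<or> u \<le> x)"
    using J(2,5) r_nonneg by (fastforce dest: subsetD)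
  note E = M.QH_Meixner_cond_moments[OF QH_Z tau_nonneg su(3) st J(3,4) K]
  show "ext_cond_exp_eq N (sigma_of N X J) (X t) (\<lambda>\<omega>. interp s t u (X s \<omega>) (X u \<omega>))"
    using bridgeD_cond_exp[OF bridge_X SU, of "\<lambda>x. x" "interp s t u"] E(1)
      M.square_integrable_imp_integrable[OF m sq] unfolding un
    by (simp add: split_beta')
  show "ext_cond_exp_eq N (sigma_of N X J) (\<lambda>\<omega>. (X t \<omega>)\<^sup>2)
      (\<lambda>\<omega>. meixner_moment2 \<theta> \<tau> s t u (X s \<omega>) (X u \<omega>))"
    using bridgeD_cond_exp[OF bridge_X SU, of "\<lambda>x. x\<^sup>2" "meixner_moment2 \<theta> \<tau> s t u"] E(2) sq
    unfolding un by (simp add: split_beta')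
qed

lemma endpoint_sequences:
  assumes "r < t" "t < v"
  obtains s u where "\<And>n. r < s n" "\<And>n. s n < t" "\<And>n. t < u n" "\<And>n. u n < v"
    "s \<longlonglongrightarrow> r" "u \<longlonglongrightarrow> v"
    "AE \<omega> in N. (\<lambda>n. X (s n) \<omega>) \<longlonglongrightarrow> zr" "AE \<omega> in N. (\<lambda>n. X (u n) \<omega>) \<longlonglongrightarrow> zv"
proof -
  \<comment> \<open>The shrinking windows of width \<open>e n\<close> force the selected times, and
    not only the values of the process, to converge to the end points.\<close>
  define e where "e n = inverse (real (Suc n))" for n
  have e: "0 < e n" for n unfolding e_def by simp
  have e0: "e \<longlonglongrightarrow> 0" unfolding e_def by (rule LIMSEQ_inverse_real_of_nat)
  have "eventually (\<lambda>x. x \<in> {r<..<min t (r + e n)}) (at_right r)" for n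
    by (rule eventually_at_right_real) (use assms e[of n] in auto)
  then have ev1: "eventually (\<lambda>x. r < x \<and> x < t \<and> x < r + e n) (at_right r)" for n
    by (rule eventually_mono) auto
  have "eventually (\<lambda>x. x \<in> {max t (v - e n)<..<v}) (at_left v)" for n
    by (rule eventually_at_left_real) (use assms e[of n] in auto)
  then have ev2: "eventually (\<lambda>x. t < x \<and> x < v \<and> v - e n < x) (at_left v)" for n
    by (rule eventually_mono) auto
  have lims: "tendsto_in_prob N X zr (at_right r)" "tendsto_in_prob N X zv (at_left v)"
    using bridge_X unfolding bridge_def by auto
  obtain s where s: "\<And>n. r < s n \<and> s n < t \<and> s n < r + e n"
    and s_lim: "AE \<omega> in N. (\<lambda>n. X (s n) \<omega>) \<longlonglongrightarrow> zr"
    by (rule N.tendsto_in_prob_AE_sequence[OF lims(1),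
          where P = "\<lambda>n x. r < x \<and> x < t \<and> x < r + e n", OF _ ev1])
      (use assms in \<open>auto intro: measurable_X\<close>)
  obtain u where u: "\<And>n. t < u n \<and> u n < v \<and> v - e n < u n"
    and u_lim: "AE \<omega> in N. (\<lambda>n. X (u n) \<omega>) \<longlonglongrightarrow> zv"
    by (rule N.tendsto_in_prob_AE_sequence[OF lims(2),
          where P = "\<lambda>n x. t < x \<and> x < v \<and> v - e n < x", OF _ ev2])
      (use assms in \<open>auto intro: measurable_X\<close>)
  have "s \<longlonglongrightarrow> r"
  proof (rule tendsto_sandwich[where f = "\<lambda>n. r" and h = "\<lambda>n. r + e n"])
    show "(\<lambda>n. r + e n) \<longlonglongrightarrow> r" using tendsto_add[OF tendsto_const e0, of r] by simp
    show "\<forall>\<^sub>F n in sequentially. r \<le> s n" "\<forall>\<^sub>F n in sequentially. s n \<le> r + e n"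
      using s by (auto intro!: always_eventually less_imp_le)
  qed simp
  moreover have "u \<longlonglongrightarrow> v"
  proof (rule tendsto_sandwich[where f = "\<lambda>n. v - e n" and h = "\<lambda>n. v"])
    show "(\<lambda>n. v - e n) \<longlonglongrightarrow> v" using tendsto_diff[OF tendsto_const e0, of v] by simp
    show "\<forall>\<^sub>F n in sequentially. v - e n \<le> u n" "\<forall>\<^sub>F n in sequentially. u n \<le> v"
      using u by (auto intro!: always_eventually less_imp_le)
  qed simp
  ultimately show ?thesis using s u s_lim u_lim by (intro that) auto
qed

lemma tendsto_interp:
  assumes "(s \<longlongrightarrow> r) F" "(u \<longlongrightarrow> v) F" "(a \<longlongrightarrow> x) F" "(b \<longlongrightarrow> y) F"
  shows "((\<lambda>n. interp (s n) t (u n) (a n) (b n)) \<longlongrightarrow> interp r t v x y) F"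
  unfolding interp_def using r_less_v by (intro tendsto_intros assms) auto

lemma tendsto_meixner_moment2:
  assumes "(s \<longlongrightarrow> r) F" "(u \<longlongrightarrow> v) F" "(a \<longlongrightarrow> x) F" "(b \<longlongrightarrow> y) F"
  shows "((\<lambda>n. meixner_moment2 \<theta> \<tau> (s n) t (u n) (a n) (b n)) \<longlongrightarrow>
    meixner_moment2 \<theta> \<tau> r t v x y) F"
  unfolding meixner_moment2_def meixner_scale_def meixner_form_def
  using r_less_v tau_nonneg by (intro tendsto_intros tendsto_interp assms) auto

text \<open>Pinning both conditioning values at the end points of the bridge makes the conditional
  moments constant in the limit. Square integrability is not assumed; it follows by Fatou's lemma.\<close>

lemma moments:
  assumes t: "r < t" "t < v"
  shows integrable_X2: "integrable N (\<lambda>\<omega>. (X t \<omega>)\<^sup>2)"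
    and mean_X: "(\<integral>\<omega>. X t \<omega> \<partial>N) = interp r t v zr zv"
    and moment2_X: "(\<integral>\<omega>. (X t \<omega>)\<^sup>2 \<partial>N) = meixner_moment2 \<theta> \<tau> r t v zr zv"
proof -
  obtain s u where su: "\<And>n. r < s n" "\<And>n. s n < t" "\<And>n. t < u n" "\<And>n. u n < v"
    and lim: "s \<longlonglongrightarrow> r" "u \<longlonglongrightarrow> v"
    and AE_lim: "AE \<omega> in N. (\<lambda>n. X (s n) \<omega>) \<longlonglongrightarrow> zr" "AE \<omega> in N. (\<lambda>n. X (u n) \<omega>) \<longlonglongrightarrow> zv"
    using endpoint_sequences[OF t] by metis
  let ?G = "\<lambda>n. sigma_of N X {s n, u n}"
  let ?L = "\<lambda>n \<omega>. interp (s n) t (u n) (X (s n) \<omega>) (X (u n) \<omega>)"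
  let ?Q = "\<lambda>n \<omega>. meixner_moment2 \<theta> \<tau> (s n) t (u n) (X (s n) \<omega>) (X (u n) \<omega>)"
  have E: "ext_cond_exp_eq N (?G n) (X t) (?L n)" "ext_cond_exp_eq N (?G n) (\<lambda>\<omega>. (X t \<omega>)\<^sup>2) (?Q n)" for n
    by (rule ext_cond_moments; use su[of n] t in auto)+
  have m: "X (s n) \<in> borel_measurable N" "X (u n) \<in> borel_measurable N" for n
    using su[of n] t by (auto intro!: measurable_X)
  have sub: "subalgebra N (?G n)" for n
    by (rule subalgebra_sigma_of) (use m in auto)
  have mG: "X (s n) \<in> borel_measurable (?G n)" "X (u n) \<in> borel_measurable (?G n)" for n
    by (rule measurable_sigma_of; simp)+
  note mLQ = borel_measurable_interp[OF mG] borel_measurable_meixner_moment2[OF mG]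
  have L_lim: "AE \<omega> in N. (\<lambda>n. ?L n \<omega>) \<longlonglongrightarrow> interp r t v zr zv"
    using AE_lim by eventually_elim (rule tendsto_interp[OF lim])
  have Q_lim: "AE \<omega> in N. (\<lambda>n. ?Q n \<omega>) \<longlonglongrightarrow> meixner_moment2 \<theta> \<tau> r t v zr zv"
    using AE_lim by eventually_elim (rule tendsto_meixner_moment2[OF lim])
  \<comment> \<open>The second moment has to precede the mean: its integrand is nonnegative, so
    Fatou applies, and integrability of \<open>X t\<close> itself is a consequence.\<close>
  show i: "integrable N (\<lambda>\<omega>. (X t \<omega>)\<^sup>2)"
    by (rule N.integrable_limit_cond_exp[OF sub mLQ(2) _ _ E(2) Q_lim])
      (simp_all add: measurable_X[OF t] borel_measurable_power)
  have EL: "AE \<omega> in N. real_cond_exp N (?G n) (X t) \<omega> = ?L n \<omega>"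
    and EQ: "AE \<omega> in N. real_cond_exp N (?G n) (\<lambda>\<omega>. (X t \<omega>)\<^sup>2) \<omega> = ?Q n \<omega>" for n
    using E[of n] unfolding ext_cond_exp_eq_def by auto
  show "(\<integral>\<omega>. X t \<omega> \<partial>N) = interp r t v zr zv"
    by (rule N.expectation_eq_limit_cond_exp[OF sub mLQ(1) _ EL L_lim])
      (rule N.square_integrable_imp_integrable[OF measurable_X[OF t] i])
  show "(\<integral>\<omega>. (X t \<omega>)\<^sup>2 \<partial>N) = meixner_moment2 \<theta> \<tau> r t v zr zv"
    by (rule N.expectation_eq_limit_cond_exp[OF sub mLQ(2) i EQ Q_lim])
qed

lemma integrable_X: "r < t \<Longrightarrow> t < v \<Longrightarrow> integrable N (X t)"
  by (rule N.square_integrable_imp_integrable[OF measurable_X integrable_X2])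

lemma integrable_XX:
  "r < s \<Longrightarrow> s < v \<Longrightarrow> r < t \<Longrightarrow> t < v \<Longrightarrow> integrable N (\<lambda>\<omega>. X s \<omega> * X t \<omega>)"
  by (rule integrable_mult_of_squares[OF measurable_X measurable_X integrable_X2 integrable_X2])

section \<open>Conditional moments given the whole past and future, and mixed moments\<close>

lemma cond_moments_finite:
  assumes J: "finite J" "J \<subseteq> {r<..<v}" "s \<in> J" "u \<in> J" "\<And>x. x \<in> J \<Longrightarrow> x \<le> s \<or> u \<le> x"
    and st: "s < t" "t < u"
  shows "AE \<omega> in N. real_cond_exp N (sigma_of N X J) (X t) \<omega> = interp s t u (X s \<omega>) (X u \<omega>)"
    and "AE \<omega> in N. real_cond_exp N (sigma_of N X J) (\<lambda>\<omega>. (X t \<omega>)\<^sup>2) \<omega>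
      = meixner_moment2 \<theta> \<tau> s t u (X s \<omega>) (X u \<omega>)"
  using ext_cond_moments[OF J st] unfolding ext_cond_exp_eq_def by auto

text \<open>Square integrability is now known, so the extended identities become ordinary ones
  between integrable functions, and these pass from finite conditioning sets to the full past and
  future.\<close>

lemma cond_moments:
  assumes st: "r < s" "s < t" "t < u" "u < v"
  shows "AE \<omega> in N. real_cond_exp N (past_future N {r<..<v} X s u) (X t) \<omega>
      = interp s t u (X s \<omega>) (X u \<omega>)"
    and "AE \<omega> in N. real_cond_exp N (past_future N {r<..<v} X s u) (\<lambda>\<omega>. (X t \<omega>)\<^sup>2) \<omega>
      = meixner_moment2 \<theta> \<tau> s t u (X s \<omega>) (X u \<omega>)"
proof -
  define K where "K = {x \<in> {r<..<v}. x \<le> s \<or> u \<le> x}"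
  have b: "s < v" "r < u" "r < t" "t < v" using st by auto
  have m: "\<And>x. x \<in> K \<Longrightarrow> X x \<in> borel_measurable N" by (auto simp: K_def intro: measurable_X)
  have J0: "finite {s, u}" "{s, u} \<subseteq> K" using st b by (auto simp: K_def)
  have mJ: "X s \<in> borel_measurable (sigma_of N X {s, u})" "X u \<in> borel_measurable (sigma_of N X {s, u})"
    by (rule measurable_sigma_of; simp)+
  note L = N.integrable_interp[OF measurable_X[OF st(1) b(1)] measurable_X[OF b(2) st(4)]
      integrable_X2[OF st(1) b(1)] integrable_X2[OF b(2) st(4)]]
  have fin: "AE \<omega> in N. real_cond_exp N (sigma_of N X J) (X t) \<omega> = interp s t u (X s \<omega>) (X u \<omega>)"
      "AE \<omega> in N. real_cond_exp N (sigma_of N X J) (\<lambda>\<omega>. (X t \<omega>)\<^sup>2) \<omega>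
      = meixner_moment2 \<theta> \<tau> s t u (X s \<omega>) (X u \<omega>)"
    if "finite J" "{s, u} \<subseteq> J" "J \<subseteq> K" for J
    by (rule cond_moments_finite; use that st in \<open>auto simp: K_def\<close>)+
  show "AE \<omega> in N. real_cond_exp N (past_future N {r<..<v} X s u) (X t) \<omega>
      = interp s t u (X s \<omega>) (X u \<omega>)"
    unfolding past_future_def K_def[symmetric]
    by (rule N.real_cond_exp_sigma_of_finite[OF m integrable_X[OF b(3,4)] L(1) J0
          borel_measurable_interp[OF mJ] fin(1)])
  show "AE \<omega> in N. real_cond_exp N (past_future N {r<..<v} X s u) (\<lambda>\<omega>. (X t \<omega>)\<^sup>2) \<omega>
      = meixner_moment2 \<theta> \<tau> s t u (X s \<omega>) (X u \<omega>)"
    unfolding past_future_def K_def[symmetric]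
    by (rule N.real_cond_exp_sigma_of_finite[OF m integrable_X2[OF b(3,4)] L(4) J0
          borel_measurable_meixner_moment2[OF mJ] fin(2)])
qed

text \<open>Conditioning on the values at s and u allows \<open>X s\<close> to be pulled out, and
  the conditional mean of \<open>X t\<close> is the chord; integrating gives a relation between
  mixed moments.\<close>

lemma product_moment_step:
  assumes st: "r < s" "s < t" "t < u" "u < v"
  shows "(\<integral>\<omega>. X s \<omega> * X t \<omega> \<partial>N) =
    (u - t) / (u - s) * (\<integral>\<omega>. (X s \<omega>)\<^sup>2 \<partial>N) + (t - s) / (u - s) * (\<integral>\<omega>. X s \<omega> * X u \<omega> \<partial>N)"
proof -
  have b: "s < v" "r < u" "r < t" "t < v" using st by auto
  let ?G = "sigma_of N X {s, u}"
  interpret G: finite_measure_subalgebra N ?G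
    by (rule N.finite_measure_subalgebra_sigma_of) (use st b in \<open>auto intro: measurable_X\<close>)
  have mG: "X s \<in> borel_measurable ?G" by (rule measurable_sigma_of) simp
  have [measurable]: "X s \<in> borel_measurable N" "X u \<in> borel_measurable N" "X t \<in> borel_measurable N"
    using st b by (auto intro: measurable_X)
  have "AE \<omega> in N. real_cond_exp N ?G (X t) \<omega> = interp s t u (X s \<omega>) (X u \<omega>)"
    by (rule cond_moments_finite) (use st b in auto)
  then have ae: "AE \<omega> in N. X s \<omega> * real_cond_exp N ?G (X t) \<omega> =
      (u - t) / (u - s) * (X s \<omega>)\<^sup>2 + (t - s) / (u - s) * (X s \<omega> * X u \<omega>)"
    by eventually_elim (simp add: interp_def power2_eq_square algebra_simps)
  have "(\<integral>\<omega>. X s \<omega> * X t \<omega> \<partial>N) = (\<integral>\<omega>. X s \<omega> * real_cond_exp N ?G (X t) \<omega> \<partial>N)"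
    by (rule G.real_cond_exp_intg(2)[symmetric])
      (use integrable_XX[of s t] st b mG in auto)
  also have "\<dots> = (\<integral>\<omega>. (u - t) / (u - s) * (X s \<omega>)\<^sup>2 + (t - s) / (u - s) * (X s \<omega> * X u \<omega>) \<partial>N)"
    by (rule integral_cong_AE[OF _ _ ae]) measurable
  also have "\<dots> = (u - t) / (u - s) * (\<integral>\<omega>. (X s \<omega>)\<^sup>2 \<partial>N) + (t - s) / (u - s) * (\<integral>\<omega>. X s \<omega> * X u \<omega> \<partial>N)"
    using integrable_X2[OF st(1) b(1)] integrable_XX[OF st(1) b(1,2) st(4)] by simp
  finally show ?thesis .
qed

text \<open>The limit u -> v of the preceding relation. Convergence in probability at v does not
  control a product. By Cauchy-Schwarz, E(X_s (X_u - zv)) is bounded through E((X_u - zv)^2), which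
  is explicit by the moment formulas and tends to 0.\<close>

lemma product_moment:
  assumes st: "r < s" "s < t" "t < v"
  shows "(\<integral>\<omega>. X s \<omega> * X t \<omega> \<partial>N) =
    (v - t) / (v - s) * meixner_moment2 \<theta> \<tau> r s v zr zv + (t - s) / (v - s) * (zv * interp r s v zr zv)"
proof -
  have sv: "s < v" using st by simp
  define A where "A = (\<integral>\<omega>. (X s \<omega>)\<^sup>2 \<partial>N)"
  have A: "A = meixner_moment2 \<theta> \<tau> r s v zr zv"
    unfolding A_def by (rule moment2_X[OF st(1) sv])
  define w where "w u = meixner_moment2 \<theta> \<tau> r u v zr zv - 2 * zv * interp r u v zr zv + zv\<^sup>2" for u
  have w: "(\<integral>\<omega>. (X u \<omega> - zv)\<^sup>2 \<partial>N) = w u" and w_int: "integrable N (\<lambda>\<omega>. (X u \<omega> - zv)\<^sup>2)"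
    if u: "r < u" "u < v" for u
  proof -
    have eq: "(\<lambda>\<omega>. (X u \<omega> - zv)\<^sup>2) = (\<lambda>\<omega>. (X u \<omega>)\<^sup>2 - 2 * zv * X u \<omega> + zv\<^sup>2)"
      by (simp add: fun_eq_iff power2_eq_square algebra_simps)
    show "integrable N (\<lambda>\<omega>. (X u \<omega> - zv)\<^sup>2)"
      unfolding eq using integrable_X[OF u] integrable_X2[OF u] by simp
    show "(\<integral>\<omega>. (X u \<omega> - zv)\<^sup>2 \<partial>N) = w u"
      unfolding eq w_def using integrable_X[OF u] integrable_X2[OF u]
      by (simp add: mean_X[OF u] moment2_X[OF u] N.prob_space)
  qed
  have near: "eventually (\<lambda>u. t < u \<and> u < v) (at_left v)"
    using eventually_at_left_real[OF st(3)] by (rule eventually_mono) auto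
  have w_lim: "(w \<longlongrightarrow> 0) (at_left v)"
  proof -
    have "(w \<longlongrightarrow> w v) (at_left v)"
      unfolding w_def meixner_moment2_def meixner_scale_def interp_def
      using r_less_v tau_nonneg by (intro tendsto_intros) auto
    moreover have "w v = 0"
      using r_less_v by (simp add: w_def meixner_moment2_def meixner_scale_def interp_def power2_eq_square)
    ultimately show ?thesis by simp
  qed
  have "((\<lambda>u. (\<integral>\<omega>. X s \<omega> * (X u \<omega> - zv) \<partial>N)) \<longlongrightarrow> 0) (at_left v)"
  proof (rule Lim_null_comparison)
    show "\<forall>\<^sub>F u in at_left v. norm (\<integral>\<omega>. X s \<omega> * (X u \<omega> - zv) \<partial>N) \<le> sqrt (A * w u)"
      using near
    proof eventually_elim
      case (elim u)
      then have u: "r < u" "u < v" using st by auto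
      have "(\<integral>\<omega>. X s \<omega> * (X u \<omega> - zv) \<partial>N)\<^sup>2 \<le> A * w u"
        unfolding A_def w[OF u, symmetric]
        by (rule integral_Cauchy_Schwarz)
          (use measurable_X[OF st(1) sv] measurable_X[OF u] integrable_X2[OF st(1) sv] w_int[OF u] in simp_all)
      then have "sqrt ((\<integral>\<omega>. X s \<omega> * (X u \<omega> - zv) \<partial>N)\<^sup>2) \<le> sqrt (A * w u)"
        by (rule real_sqrt_le_mono)
      then show ?case by simp
    qed
    have "((\<lambda>u. sqrt (A * w u)) \<longlongrightarrow> sqrt (A * 0)) (at_left v)"
      by (intro tendsto_intros w_lim)
    then show "((\<lambda>u. sqrt (A * w u)) \<longlongrightarrow> 0) (at_left v)" by simp
  qed
  then have lim: "((\<lambda>u. (u - t) / (u - s) * A + (t - s) / (u - s) *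
      (zv * interp r s v zr zv + (\<integral>\<omega>. X s \<omega> * (X u \<omega> - zv) \<partial>N))) \<longlongrightarrow>
      (v - t) / (v - s) * A + (t - s) / (v - s) * (zv * interp r s v zr zv + 0)) (at_left v)"
    using sv by (intro tendsto_intros) auto
  \<comment> \<open>By the one-step relation the expression does not depend on u near v, so its
    limit is its value.\<close>
  have ev: "\<forall>\<^sub>F u in at_left v. (u - t) / (u - s) * A + (t - s) / (u - s) *
      (zv * interp r s v zr zv + (\<integral>\<omega>. X s \<omega> * (X u \<omega> - zv) \<partial>N)) = (\<integral>\<omega>. X s \<omega> * X t \<omega> \<partial>N)"
    using near
  proof eventually_elim
    case (elim u)
    then have u: "r < u" "u < v" "t < u" using st by auto
    have "(\<integral>\<omega>. X s \<omega> * (X u \<omega> - zv) \<partial>N) = (\<integral>\<omega>. X s \<omega> * X u \<omega> \<partial>N) - zv * interp r s v zr zv"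
      unfolding mean_X[OF st(1) sv, symmetric] right_diff_distrib
      using integrable_XX[OF st(1) sv u(1,2)] integrable_X[OF st(1) sv] by simp
    then show ?case
      using product_moment_step[OF st(1,2) u(3,2)] by (simp add: A_def)
  qed
  have "((\<lambda>u. (\<integral>\<omega>. X s \<omega> * X t \<omega> \<partial>N)) \<longlongrightarrow>
      (v - t) / (v - s) * A + (t - s) / (v - s) * (zv * interp r s v zr zv + 0)) (at_left v)"
    by (rule Lim_transform_eventually[OF lim ev])
  then have "(\<integral>\<omega>. X s \<omega> * X t \<omega> \<partial>N) =
      (v - t) / (v - s) * A + (t - s) / (v - s) * (zv * interp r s v zr zv + 0)"
    by (rule tendsto_unique[OF trivial_limit_at_left_real tendsto_const])
  then show ?thesis by (simp add: A)
qed

end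

section \<open>The transformed bridge\<close>

context
  fixes r v :: real
  assumes r_less_v: "r < v"
begin

text \<open>The inverse of y |-> (y - r)/(v - y): the new time t is the ratio of the distances of
  the old time to the two end points.\<close>

private abbreviation (input) \<phi> :: "real \<Rightarrow> real" where "\<phi> t \<equiv> (v * t + r) / (1 + t)"

lemma time_change_bounds:
  assumes "0 < t"
  shows "\<phi> t - r = (v - r) * t / (1 + t)" "v - \<phi> t = (v - r) / (1 + t)" "r < \<phi> t" "\<phi> t < v"
proof -
  show eq: "\<phi> t - r = (v - r) * t / (1 + t)" "v - \<phi> t = (v - r) / (1 + t)"
    using assms by (simp_all add: field_simps)
  have "0 < \<phi> t - r" "0 < v - \<phi> t" unfolding eq using assms r_less_v by simp_all
  then show "r < \<phi> t" "\<phi> t < v" by simp_all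
qed

lemma time_change_diff:
  assumes "0 < s" "0 < t"
  shows "\<phi> t - \<phi> s = (v - r) * (t - s) / ((1 + s) * (1 + t))"
  using assms by (simp add: field_simps)

lemma time_change_less_iff:
  assumes "0 < s" "0 < t"
  shows "\<phi> s < \<phi> t \<longleftrightarrow> s < t"
proof -
  define \<kappa> where "\<kappa> = (v - r) / ((1 + s) * (1 + t))"
  have \<kappa>: "0 < \<kappa>" unfolding \<kappa>_def using assms r_less_v by simp
  have "\<phi> s < \<phi> t \<longleftrightarrow> 0 < \<phi> t - \<phi> s" by simp
  also have "\<phi> t - \<phi> s = \<kappa> * (t - s)"
    unfolding time_change_diff[OF assms] \<kappa>_def by simp
  also have "0 < \<kappa> * (t - s) \<longleftrightarrow> s < t" using \<kappa> by (simp add: zero_less_mult_iff)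
  finally show ?thesis .
qed

lemma time_change_image:
  assumes "0 < s" "0 < u"
  shows "\<phi> ` {x \<in> {0<..}. x \<le> s \<or> u \<le> x} = {y \<in> {r<..<v}. y \<le> \<phi> s \<or> \<phi> u \<le> y}"
proof -
  define f where "f = (\<lambda>t. \<phi> t)"
  have le: "f x \<le> f y \<longleftrightarrow> x \<le> y" if "0 < x" "0 < y" for x y
    using time_change_less_iff[OF that(2,1)] unfolding f_def by linarith
  have bounds: "r < f x" "f x < v" if "0 < x" for x
    using time_change_bounds(3,4)[OF that] unfolding f_def by auto
  have surj: "\<exists>x>0. f x = y" if y: "r < y" "y < v" for y
  proof -
    define x where "x = (y - r) / (v - y)"
    have "0 < x" using y by (simp add: x_def)
    have "1 + x = (v - r) / (v - y)" "v * x + r = y * (v - r) / (v - y)"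
      using y by (simp_all add: x_def field_simps)
    then have "f x = y" unfolding f_def using y r_less_v by simp
    with \<open>0 < x\<close> show ?thesis by blast
  qed
  have "f ` {x \<in> {0<..}. x \<le> s \<or> u \<le> x} = {y \<in> {r<..<v}. y \<le> f s \<or> f u \<le> y}"
  proof safe
    fix y assume y: "y \<in> {r<..<v}"
    then obtain x where x: "0 < x" "f x = y" using surj[of y] by auto
    show "y \<in> f ` {x \<in> {0<..}. x \<le> s \<or> u \<le> x}" if "y \<le> f s"
      using that x le[OF x(1) assms(1)] by blast
    show "y \<in> f ` {x \<in> {0<..}. x \<le> s \<or> u \<le> x}" if "f u \<le> y"
      using that x le[OF assms(2) x(1)] by blast
  qed (use bounds le assms in auto)
  then show ?thesis unfolding f_def .
qed

text \<open>This mean of the bridge at the changed time is why t zv + zr is subtracted from (1 + t)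
  X in the definition of \<open>Y\<close>.\<close>

lemma interp_time_change_endpoints:
  assumes "0 < t"
  shows "interp r (\<phi> t) v zr zv = (t * zv + zr) / (1 + t)"
  unfolding interp_def time_change_bounds(1,2)[OF assms]
  using r_less_v by (simp add: add_divide_distrib)

text \<open>The time change is fractional linear, so after multiplication by 1 + t chords become
  chords in the new time. This is the origin of the factor 1 + t in \<open>Y\<close>.\<close>

lemma interp_time_change:
  assumes st: "0 < s" "s < t" "t < u"
  shows "interp (\<phi> s) (\<phi> t) (\<phi> u) a b =
    ((u - t) / (u - s) * ((1 + s) * a) + (t - s) / (u - s) * ((1 + u) * b)) / (1 + t)"
proof -
  have pos: "0 < t" "0 < u" using st by auto
  have *: "v - r \<noteq> 0" "u - s \<noteq> 0" "1 + s \<noteq> 0" "1 + t \<noteq> 0" "1 + u \<noteq> 0"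
    using st r_less_v by auto
  show ?thesis
    unfolding interp_def time_change_diff[OF st(1) pos(2)] time_change_diff[OF st(1) pos(1)]
      time_change_diff[OF pos]
    using * by (simp add: divide_simps)
qed

end

text \<open>In terms of the increments \<open>A\<close> and \<open>B\<close> of the transformed process, the slope of the bridge
  between the two conditioning points is its overall slope \<open>\<Delta>\<close> plus a multiple of \<open>B - A\<close>; expanding
  the quadratic form around \<open>\<Delta>\<close> gives the new parameters.\<close>

lemma meixner_form_time_change:
  fixes r v \<tau> \<theta> \<Delta> zr zv s u a b :: real
  defines "\<phi> \<equiv> \<lambda>t. (v * t + r) / (1 + t)"
    and "c \<equiv> 1 + \<theta> * \<Delta> + \<tau> * \<Delta>\<^sup>2" and "w \<equiv> v - r + \<tau>"
  defines "k \<equiv> sqrt w / ((v - r) * sqrt c)"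
    and "\<theta>' \<equiv> (\<theta> + 2 * \<tau> * \<Delta>) / (sqrt w * sqrt c)"
  defines "ya \<equiv> k * ((1 + s) * a - s * zv - zr)" and "yb \<equiv> k * ((1 + u) * b - u * zv - zr)"
  defines "A \<equiv> (u * ya - s * yb) / (u - s)" and "B \<equiv> (yb - ya) / (u - s)"
  assumes \<tau>: "0 \<le> \<tau>" and rv: "r < v" and su: "0 < s" "s < u"
    and \<Delta>: "\<Delta> = (zv - zr) / (v - r)" and c: "0 < c"
  shows "meixner_form \<theta> \<tau> (\<phi> s) (\<phi> u) a b =
    c * (1 + (- \<theta>') * A + \<theta>' * B + \<tau> / w * A\<^sup>2 + \<tau> / w * B\<^sup>2 - (1 - (v - r - \<tau>) / w) * (B * A))"
proof -
  have u: "0 < u" using su by simp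
  have w: "0 < w" using \<tau> rv by (simp add: w_def)
  define d e where "d = u - s" and "e = v - r"
  have de: "0 < d" "0 < e" using su rv by (simp_all add: d_def e_def)
  have k: "0 < k" using w c rv by (simp add: k_def)
  \<comment> \<open>The chord of the transformed path is A + B x. At x = -1, the pole of the time
    change, its value is A - B, and the slope of the original chord is affine in this value
    alone.\<close>
  have "B - A = ((1 + s) * yb - (1 + u) * ya) / d"
    unfolding A_def B_def d_def[symmetric] by (simp add: diff_divide_distrib[symmetric] algebra_simps)
  also have "(1 + s) * yb - (1 + u) * ya = k * ((1 + s) * (1 + u) * (b - a) - d * (zv - zr))"
    unfolding ya_def yb_def d_def by (simp add: algebra_simps)
  finally have BA: "B - A = k * ((1 + s) * (1 + u) * (b - a) / d - (zv - zr))"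
    using de by (simp add: diff_divide_distrib right_diff_distrib)
  have "(b - a) / (\<phi> u - \<phi> s) = (1 + s) * (1 + u) * (b - a) / (e * d)"
    unfolding \<phi>_def time_change_diff[OF rv su(1) u] d_def[symmetric] e_def[symmetric]
    using su u by (simp add: mult_ac)
  also have "\<dots> = \<Delta> + (B - A) / (k * e)"
    unfolding BA \<Delta> e_def[symmetric] using k de by (simp add: field_simps)
  finally have slope: "(b - a) / (\<phi> u - \<phi> s) = \<Delta> + (B - A) / (k * e)" .
  have sq: "(sqrt c)\<^sup>2 = c" "(sqrt w)\<^sup>2 = w" "sqrt c \<noteq> 0" "sqrt w \<noteq> 0" using c w by simp_all
  have "k * e = sqrt w / sqrt c" using de by (simp add: k_def e_def)
  then have inv: "(B - A) / (k * e) = (B - A) * sqrt c / sqrt w" by simp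
  have lin: "(\<theta> + 2 * \<tau> * \<Delta>) * ((B - A) * sqrt c / sqrt w) = c * (\<theta>' * (B - A))"
  proof -
    have "K * (E * p / q) = p\<^sup>2 * (K / (q * p) * E)" if "p \<noteq> 0" "q \<noteq> 0" for K E p q :: real
      using that by (simp add: field_simps power2_eq_square)
    from this[OF sq(3,4)] show ?thesis unfolding \<theta>'_def sq(1) .
  qed
  have quad: "\<tau> * ((B - A) * sqrt c / sqrt w)\<^sup>2 = c * (\<tau> / w * (B - A)\<^sup>2)"
    by (simp add: power_divide power_mult_distrib sq)
  \<comment> \<open>The origin of \<gamma>: the cross term of \<tau>/w times (B - A)^2 has
    coefficient -2 \<tau>/w.\<close>
  have \<gamma>: "1 - (v - r - \<tau>) / w = 2 * (\<tau> / w)"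
    using w by (simp add: w_def field_simps)
  have "meixner_form \<theta> \<tau> (\<phi> s) (\<phi> u) a b =
      c + (\<theta> + 2 * \<tau> * \<Delta>) * ((B - A) * sqrt c / sqrt w) + \<tau> * ((B - A) * sqrt c / sqrt w)\<^sup>2"
  proof -
    \<comment> \<open>Taylor expansion at \<Delta>, exact for a quadratic; the derivative \<theta> +
      2 \<tau> \<Delta> is the numerator of the new linear parameter.\<close>
    have "1 + \<theta> * (\<Delta> + x) + \<tau> * (\<Delta> + x)\<^sup>2 = c + (\<theta> + 2 * \<tau> * \<Delta>) * x + \<tau> * x\<^sup>2" for x
      unfolding c_def by (simp add: power2_eq_square algebra_simps)
    then show ?thesis unfolding meixner_form_def slope inv .
  qed
  also have "\<dots> = c + c * (\<theta>' * (B - A)) + c * (\<tau> / w * (B - A)\<^sup>2)"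
    unfolding lin quad ..
  also have "\<dots> = c * (1 + (- \<theta>') * A + \<theta>' * B + \<tau> / w * A\<^sup>2 + \<tau> / w * B\<^sup>2
      - (1 - (v - r - \<tau>) / w) * (B * A))"
  proof -
    have "c + c * (x * (B - A)) + c * (y * (B - A)\<^sup>2) =
        c * (1 + (- x) * A + x * B + y * A\<^sup>2 + y * B\<^sup>2 - 2 * y * (B * A))" for x y
      by (simp add: power2_eq_square algebra_simps)
    then show ?thesis unfolding \<gamma> .
  qed
  finally show ?thesis .
qed

section \<open>Covariance of the bridge and of its affine images\<close>

context meixner_bridge
begin

text \<open>The mean function is the chord from (r, zr) to (v, zv), so the product of the means
  splits off, and pinning at v damps the variance at s by (v - t)/(v - s). The diagonal s = t is the
  plain second moment.\<close>

lemma covariance: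
  assumes st: "r < s" "s \<le> t" "t < v"
  shows "(\<integral>\<omega>. X s \<omega> * X t \<omega> \<partial>N) = interp r s v zr zv * interp r t v zr zv +
    (v - t) / (v - s) * (meixner_scale \<tau> r s v * meixner_form \<theta> \<tau> r v zr zv)"
proof (cases "s = t")
  case True
  then show ?thesis
    using moment2_X[of t] st by (simp add: meixner_moment2_def power2_eq_square)
next
  case False
  have "interp r t v zr zv = (v - t) / (v - s) * interp r s v zr zv + (t - s) / (v - s) * zv"
  proof -
    have "v - r \<noteq> 0" "v - s \<noteq> 0" using st by auto
    then show ?thesis unfolding interp_def by (simp add: divide_simps) (simp add: algebra_simps)
  qed
  moreover have "(\<integral>\<omega>. X s \<omega> * X t \<omega> \<partial>N) =
      (v - t) / (v - s) * meixner_moment2 \<theta> \<tau> r s v zr zv + (t - s) / (v - s) * (zv * interp r s v zr zv)"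
    using product_moment[of s t] False st by simp
  ultimately show ?thesis
    unfolding meixner_moment2_def by (simp add: power2_eq_square distrib_left mult_ac)
qed

lemma expectation_affine_product:
  assumes s: "r < s" "s < v" and t: "r < t" "t < v"
  shows "(\<integral>\<omega>. (a * X s \<omega> + b) * (a' * X t \<omega> + b') \<partial>N) =
    a * a' * (\<integral>\<omega>. X s \<omega> * X t \<omega> \<partial>N) + a * b' * interp r s v zr zv + a' * b * interp r t v zr zv + b * b'"
proof -
  have "(\<integral>\<omega>. (a * X s \<omega> + b) * (a' * X t \<omega> + b') \<partial>N) =
      (\<integral>\<omega>. a * a' * (X s \<omega> * X t \<omega>) + a * b' * X s \<omega> + a' * b * X t \<omega> + b * b' \<partial>N)"
    by (intro Bochner_Integration.integral_cong refl) (simp add: algebra_simps)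
  also have "\<dots> = a * a' * (\<integral>\<omega>. X s \<omega> * X t \<omega> \<partial>N) + a * b' * (\<integral>\<omega>. X s \<omega> \<partial>N)
      + a' * b * (\<integral>\<omega>. X t \<omega> \<partial>N) + b * b'"
    using integrable_XX[OF s t] integrable_X[OF s] integrable_X[OF t] by (simp add: N.prob_space)
  finally show ?thesis by (simp add: mean_X s t)
qed

end

section \<open>The transformed bridge as a quadratic harness\<close>

theorem proposition2p6:
  fixes M :: "'a measure" and N :: "'b measure"
    and Z :: "real \<Rightarrow> 'a \<Rightarrow> real" and X Y :: "real \<Rightarrow> 'b \<Rightarrow> real"
    and \<tau> \<theta> r v zr zv \<Delta> :: real
  assumes "prob_space M" and "prob_space N"
    and "\<tau> \<ge> 0"
    and "QH M {0<..} Z 0 \<theta> 0 \<tau> 1"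
    and "0 \<le> r" and "r < v"
    and "bridge N X r zr v zv M {0<..} Z"
    and "\<Delta> = (zv - zr) / (v - r)"
    and "1 + \<theta> * \<Delta> + \<tau> * \<Delta>\<^sup>2 > 0"
    and "\<And>t \<omega>. t > 0 \<Longrightarrow> \<omega> \<in> space N \<Longrightarrow>
      Y t \<omega> = sqrt (v - r + \<tau>) / ((v - r) * sqrt (1 + \<theta> * \<Delta> + \<tau> * \<Delta>\<^sup>2)) *
        ((1 + t) * X ((v * t + r) / (1 + t)) \<omega> - t * zv - zr)"
  shows "QH N {0<..} Y
      (- ((\<theta> + 2 * \<tau> * \<Delta>) / (sqrt (v - r + \<tau>) * sqrt (1 + \<theta> * \<Delta> + \<tau> * \<Delta>\<^sup>2))))
      ((\<theta> + 2 * \<tau> * \<Delta>) / (sqrt (v - r + \<tau>) * sqrt (1 + \<theta> * \<Delta> + \<tau> * \<Delta>\<^sup>2)))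
      (\<tau> / (v - r + \<tau>))
      (\<tau> / (v - r + \<tau>))
      ((v - r - \<tau>) / (v - r + \<tau>))"
proof -
  interpret M: prob_space M by fact
  interpret N: prob_space N by fact
  interpret meixner_bridge M N Z X \<tau> \<theta> r v zr zv
    by unfold_locales fact+
  define \<phi> where "\<phi> t = (v * t + r) / (1 + t)" for t
  define c where "c = 1 + \<theta> * \<Delta> + \<tau> * \<Delta>\<^sup>2"
  define w where "w = v - r + \<tau>"
  define k where "k = sqrt w / ((v - r) * sqrt c)"
  define \<alpha> where "\<alpha> t = k * (1 + t)" for t
  define \<beta> where "\<beta> t = - (k * (t * zv + zr))" for t
  have c: "0 < c" using assms(9) by (simp add: c_def)
  have w: "0 < w" using assms(3,6) by (simp add: w_def)
  have k: "0 < k" using c w assms(6) by (simp add: k_def)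
  have Y_raw: "Y t \<omega> = k * ((1 + t) * X (\<phi> t) \<omega> - t * zv - zr)" if "0 < t" "\<omega> \<in> space N" for t \<omega>
    using assms(10)[OF that] unfolding k_def c_def w_def \<phi>_def .
  then have Y: "Y t \<omega> = \<alpha> t * X (\<phi> t) \<omega> + \<beta> t" if "0 < t" "\<omega> \<in> space N" for t \<omega>
    unfolding Y_raw[OF that] by (simp add: \<alpha>_def \<beta>_def algebra_simps)
  have \<alpha>: "\<alpha> t \<noteq> 0" if "0 < t" for t using k that by (simp add: \<alpha>_def)
  have \<phi>: "r < \<phi> t" "\<phi> t < v" if "0 < t" for t
    using time_change_bounds[OF r_less_v that] by (auto simp: \<phi>_def)
  have \<phi>_less: "\<phi> s < \<phi> t" if "0 < s" "s < t" for s t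
    using time_change_less_iff[OF r_less_v, of s t] that by (simp add: \<phi>_def)
  have Xm: "X (\<phi> t) \<in> borel_measurable N" if "0 < t" for t
    using measurable_X \<phi> that by blast
  have Ym: "Y t \<in> borel_measurable N" if "0 < t" for t
  proof -
    have [measurable]: "X (\<phi> t) \<in> borel_measurable N" by (rule Xm[OF that])
    have "(\<lambda>\<omega>. \<alpha> t * X (\<phi> t) \<omega> + \<beta> t) \<in> borel_measurable N" by measurable
    then show ?thesis by (rule measurable_cong[THEN iffD2, rotated]) (rule Y[OF that])
  qed
  have mean: "\<alpha> t * interp r (\<phi> t) v zr zv + \<beta> t = 0" if "0 < t" for t
    unfolding \<phi>_def interp_time_change_endpoints[OF r_less_v that]
    using that by (simp add: \<alpha>_def \<beta>_def)
  have filtration: "past_future N {0<..} Y s u = past_future N {r<..<v} X (\<phi> s) (\<phi> u)"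
    if "0 < s" "0 < u" for s u
    unfolding past_future_def
    by (rule sigma_of_reparametrize[where a = \<alpha> and b = \<beta> and \<phi> = \<phi>])
      (use Y \<alpha> time_change_image[OF r_less_v that] in \<open>auto simp: \<phi>_def\<close>)
  have cov: "(\<integral>\<omega>. Y s \<omega> * Y t \<omega> \<partial>N) = s" if st: "0 < s" "s \<le> t" for s t
  proof -
    have t: "0 < t" using st by simp
    have le: "\<phi> s \<le> \<phi> t" using \<phi>_less[of s t] st by (cases "s = t") auto
    have scale: "(v - \<phi> t) / (v - \<phi> s) * meixner_scale \<tau> r (\<phi> s) v = s * ((v - r)\<^sup>2 / w) / ((1 + s) * (1 + t))"
    proof -
      have gen: "(e / q / (e / p)) * ((e * s / p) * (e / p) / w) = s * (e\<^sup>2 / w) / (p * q)"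
        if "e \<noteq> 0" "p \<noteq> 0" "q \<noteq> 0" for e p q :: real
        using that w by (simp add: power2_eq_square mult_ac)
      show ?thesis
        unfolding meixner_scale_def w_def[symmetric] unfolding \<phi>_def
          time_change_bounds(1,2)[OF r_less_v st(1)] time_change_bounds(2)[OF r_less_v t]
        by (rule gen) (use st t r_less_v in auto)
    qed
    have form: "meixner_form \<theta> \<tau> r v zr zv = c"
      unfolding meixner_form_def c_def assms(8) by simp
    \<comment> \<open>The normalising equation that determines the prefactor \<open>k\<close>; with
      it the covariance is exactly s.\<close>
    have kk: "k\<^sup>2 * ((v - r)\<^sup>2 / w) * c = 1"
    proof -
      have "(p / (e * q))\<^sup>2 * (e\<^sup>2 / p\<^sup>2) * q\<^sup>2 = 1" if "e \<noteq> 0" "p \<noteq> 0" "q \<noteq> 0" for e p q :: real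
        using that by (simp add: power_divide power_mult_distrib)
      moreover have "(sqrt w)\<^sup>2 = w" "(sqrt c)\<^sup>2 = c" "sqrt w \<noteq> 0" "sqrt c \<noteq> 0" "v - r \<noteq> 0"
        using c w r_less_v by auto
      ultimately show ?thesis unfolding k_def by metis
    qed
    have "(\<integral>\<omega>. Y s \<omega> * Y t \<omega> \<partial>N) =
        (\<integral>\<omega>. (\<alpha> s * X (\<phi> s) \<omega> + \<beta> s) * (\<alpha> t * X (\<phi> t) \<omega> + \<beta> t) \<partial>N)"
      by (intro Bochner_Integration.integral_cong refl) (simp add: Y st t)
    \<comment> \<open>Grouped so that the product of the two means stands alone; it vanishes by the
      centring of \<open>Y\<close>.\<close>
    also have "\<dots> = (\<alpha> s * interp r (\<phi> s) v zr zv + \<beta> s) * (\<alpha> t * interp r (\<phi> t) v zr zv + \<beta> t)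
        + \<alpha> s * \<alpha> t * ((v - \<phi> t) / (v - \<phi> s) * meixner_scale \<tau> r (\<phi> s) v) * meixner_form \<theta> \<tau> r v zr zv"
      unfolding expectation_affine_product[OF \<phi>[OF st(1)] \<phi>[OF t]]
        covariance[OF \<phi>(1)[OF st(1)] le \<phi>(2)[OF t]]
      by (simp add: algebra_simps)
    also have "\<dots> = \<alpha> s * \<alpha> t * (s * ((v - r)\<^sup>2 / w) / ((1 + s) * (1 + t))) * c"
      unfolding mean[OF st(1)] scale form by simp
    also have "\<dots> = s * (k\<^sup>2 * ((v - r)\<^sup>2 / w) * c)"
      using st t by (simp add: \<alpha>_def power2_eq_square)
    finally show ?thesis unfolding kk by simp
  qed
  have Y2: "integrable N (\<lambda>\<omega>. (Y t \<omega>)\<^sup>2)" if t: "0 < t" for t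
  proof -
    have "integrable N (\<lambda>\<omega>. (\<alpha> t * X (\<phi> t) \<omega> + \<beta> t * 1)\<^sup>2)"
      by (rule integrable_square_lincomb) (use Xm integrable_X2 \<phi> t in auto)
    then show ?thesis
      by (rule Bochner_Integration.integrable_cong[OF refl, THEN iffD1, rotated]) (simp add: Y t)
  qed
  have cond: "AE \<omega> in N. real_cond_exp N (past_future N {0<..} Y s u) (Y t) \<omega> =
        (u - t) / (u - s) * Y s \<omega> + (t - s) / (u - s) * Y u \<omega>" (is ?E)
    "AE \<omega> in N. cond_var N (past_future N {0<..} Y s u) (Y t) \<omega> =
        (\<alpha> t)\<^sup>2 * (meixner_scale \<tau> (\<phi> s) (\<phi> t) (\<phi> u) *
          meixner_form \<theta> \<tau> (\<phi> s) (\<phi> u) (X (\<phi> s) \<omega>) (X (\<phi> u) \<omega>))" (is ?V)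
    if st: "0 < s" "s < t" "t < u" for s t u
  proof -
    have pos: "0 < t" "0 < u" using st by auto
    let ?F = "past_future N {r<..<v} X (\<phi> s) (\<phi> u)"
    let ?L = "\<lambda>\<omega>. interp (\<phi> s) (\<phi> t) (\<phi> u) (X (\<phi> s) \<omega>) (X (\<phi> u) \<omega>)"
    interpret F: finite_measure_subalgebra N ?F
      unfolding past_future_def
      by (rule N.finite_measure_subalgebra_sigma_of) (auto intro: measurable_X)
    note E = cond_moments[OF \<phi>(1)[OF st(1)] \<phi>_less[OF st(1,2)] \<phi>_less[OF pos(1) st(3)] \<phi>(2)[OF pos(2)]]
    have Y_AE: "AE \<omega> in N. Y x \<omega> = \<alpha> x * X (\<phi> x) \<omega> + \<beta> x" if "0 < x" for x
      using Y[OF that] by (intro AE_I2)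
    have meas: "(\<lambda>\<omega>. \<alpha> t * X (\<phi> t) \<omega> + \<beta> t) \<in> borel_measurable N"
      using Xm[OF pos(1)] by measurable
    have L: "\<alpha> t * ?L \<omega> + \<beta> t = (u - t) / (u - s) * (\<alpha> s * X (\<phi> s) \<omega> + \<beta> s)
        + (t - s) / (u - s) * (\<alpha> u * X (\<phi> u) \<omega> + \<beta> u)" for \<omega>
    proof -
      \<comment> \<open>The weights sum to 1 and average s and u to t. Since \<beta> is affine in
        time, the deterministic parts therefore interpolate exactly, while \<alpha> absorbs the
        denominator 1 + t.\<close>
      define p q where "p = (u - t) / (u - s)" and "q = (t - s) / (u - s)"
      have pq: "p + q = 1" using st by (simp add: p_def q_def flip: add_divide_distrib)
      have "p * s + q * u = ((u - t) * s + (t - s) * u) / (u - s)"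
        by (simp add: p_def q_def add_divide_distrib)
      also have "(u - t) * s + (t - s) * u = t * (u - s)" by (simp add: algebra_simps)
      finally have t: "p * s + q * u = t" using st by simp
      have "\<beta> t = - (k * ((p * s + q * u) * zv + (p + q) * zr))"
        unfolding t pq by (simp add: \<beta>_def)
      also have "\<dots> = p * \<beta> s + q * \<beta> u" by (simp add: \<beta>_def algebra_simps)
      finally have \<beta>: "\<beta> t = p * \<beta> s + q * \<beta> u" .
      have "\<alpha> t * ?L \<omega> = k * (p * ((1 + s) * X (\<phi> s) \<omega>) + q * ((1 + u) * X (\<phi> u) \<omega>))"
        unfolding \<phi>_def interp_time_change[OF r_less_v st] p_def[symmetric] q_def[symmetric]
        using pos by (simp add: \<alpha>_def)
      then show ?thesis
        unfolding p_def[symmetric] q_def[symmetric] \<beta> by (simp add: \<alpha>_def algebra_simps)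
    qed
    have "AE \<omega> in N. real_cond_exp N ?F (Y t) \<omega> = real_cond_exp N ?F (\<lambda>\<omega>. \<alpha> t * X (\<phi> t) \<omega> + \<beta> t) \<omega>"
      by (rule F.real_cond_exp_cong[OF Y_AE[OF pos(1)] Ym[OF pos(1)] meas])
    moreover have "AE \<omega> in N. real_cond_exp N ?F (\<lambda>\<omega>. \<alpha> t * X (\<phi> t) \<omega> + \<beta> t) \<omega> = \<alpha> t * ?L \<omega> + \<beta> t"
      by (rule F.real_cond_exp_affine[OF integrable_X[OF \<phi>[OF pos(1)]] E(1)])
    ultimately show ?E
      unfolding filtration[OF st(1) pos(2)] using Y_AE[OF st(1)] Y_AE[OF pos(2)]
      by eventually_elim (simp add: L)
    have "AE \<omega> in N. cond_var N ?F (Y t) \<omega> = cond_var N ?F (\<lambda>\<omega>. \<alpha> t * X (\<phi> t) \<omega> + \<beta> t) \<omega>"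
      by (rule F.cond_var_cong[OF Y_AE[OF pos(1)] Ym[OF pos(1)] meas])
    moreover have "AE \<omega> in N. cond_var N ?F (\<lambda>\<omega>. \<alpha> t * X (\<phi> t) \<omega> + \<beta> t) \<omega> =
        (\<alpha> t)\<^sup>2 * (real_cond_exp N ?F (\<lambda>\<omega>. (X (\<phi> t) \<omega>)\<^sup>2) \<omega> - (?L \<omega>)\<^sup>2)"
    proof (rule F.cond_var_affine)
      have "X (\<phi> s) \<in> borel_measurable ?F" "X (\<phi> u) \<in> borel_measurable ?F"
        unfolding past_future_def using \<phi> st pos by (auto intro!: measurable_sigma_of)
      then show "?L \<in> borel_measurable ?F" by (rule borel_measurable_interp)
      show "integrable N (\<lambda>\<omega>. (?L \<omega>)\<^sup>2)"
        by (rule N.integrable_interp) (use Xm integrable_X2 \<phi> st pos in auto)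
    qed (use Xm integrable_X2 \<phi> pos E in auto)
    ultimately show ?V
      unfolding filtration[OF st(1) pos(2)] using E(2)
      by eventually_elim (simp add: meixner_moment2_def)
  qed
  show ?thesis
    unfolding QH_def
  proof (intro conjI)
    show "open {0::real<..}" "is_interval {0::real<..}" "{0::real<..} \<noteq> {}" "{0::real<..} \<subseteq> {0<..}"
      by (auto simp: is_interval_1)
    show "\<forall>t\<in>{0<..}. Y t \<in> borel_measurable N \<and> integrable N (\<lambda>\<omega>. (Y t \<omega>)\<^sup>2)"
      using Ym Y2 by auto
    show "\<forall>t\<in>{0<..}. (\<integral>\<omega>. Y t \<omega> \<partial>N) = 0"
    proof
      fix t :: real assume "t \<in> {0<..}"
      then have t: "0 < t" by simp
      have "(\<integral>\<omega>. Y t \<omega> \<partial>N) = (\<integral>\<omega>. \<alpha> t * X (\<phi> t) \<omega> + \<beta> t \<partial>N)"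
        by (intro Bochner_Integration.integral_cong refl) (simp add: Y t)
      also have "\<dots> = \<alpha> t * interp r (\<phi> t) v zr zv + \<beta> t"
        using integrable_X[OF \<phi>[OF t]] by (simp add: mean_X[OF \<phi>[OF t]] N.prob_space)
      finally show "(\<integral>\<omega>. Y t \<omega> \<partial>N) = 0" using mean[OF t] by simp
    qed
    show "\<forall>s\<in>{0<..}. \<forall>t\<in>{0<..}. (\<integral>\<omega>. Y s \<omega> * Y t \<omega> \<partial>N) = min s t"
    proof (intro ballI)
      fix s t :: real assume "s \<in> {0<..}" "t \<in> {0<..}"
      then show "(\<integral>\<omega>. Y s \<omega> * Y t \<omega> \<partial>N) = min s t"
        using cov[of s t] cov[of t s] by (cases "s \<le> t") (auto simp: mult.commute min_def)
    qed
    show "\<forall>s\<in>{0<..}. \<forall>t\<in>{0<..}. \<forall>u\<in>{0<..}. s < t \<longrightarrow> t < u \<longrightarrow>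
        (AE \<omega> in N. real_cond_exp N (past_future N {0<..} Y s u) (Y t) \<omega> =
           (u - t) / (u - s) * Y s \<omega> + (t - s) / (u - s) * Y u \<omega>)"
      using cond(1) by simp
  next
    \<comment> \<open>The non-random factor also contains \<open>c\<close>, the value of the Meixner
      form at the pinned end points, which the expansion around \<Delta> pulls out in front.\<close>
    let ?G = "\<lambda>t s u. (\<alpha> t)\<^sup>2 * meixner_scale \<tau> (\<phi> s) (\<phi> t) (\<phi> u) * c"
    show "\<exists>F. \<forall>s\<in>{0<..}. \<forall>t\<in>{0<..}. \<forall>u\<in>{0<..}. s < t \<longrightarrow> t < u \<longrightarrow>
        (AE \<omega> in N. cond_var N (past_future N {0<..} Y s u) (Y t) \<omega> =
           F t s u *
             (1 + - ((\<theta> + 2 * \<tau> * \<Delta>) / (sqrt (v - r + \<tau>) * sqrt (1 + \<theta> * \<Delta> + \<tau> * \<Delta>\<^sup>2)))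
                    * ((u * Y s \<omega> - s * Y u \<omega>) / (u - s))
                + (\<theta> + 2 * \<tau> * \<Delta>) / (sqrt (v - r + \<tau>) * sqrt (1 + \<theta> * \<Delta> + \<tau> * \<Delta>\<^sup>2))
                    * ((Y u \<omega> - Y s \<omega>) / (u - s))
                + \<tau> / (v - r + \<tau>) * ((u * Y s \<omega> - s * Y u \<omega>)\<^sup>2 / (u - s)\<^sup>2)
                + \<tau> / (v - r + \<tau>) * ((Y u \<omega> - Y s \<omega>)\<^sup>2 / (u - s)\<^sup>2)
                - (1 - (v - r - \<tau>) / (v - r + \<tau>))
                    * ((Y u \<omega> - Y s \<omega>) * (u * Y s \<omega> - s * Y u \<omega>) / (u - s)\<^sup>2)))"
    proof (intro exI[of _ ?G] ballI impI)
      fix s t u :: real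
      assume "s \<in> {0<..}" and "s < t" "t < u"
      then have st: "0 < s" "s < t" "t < u" and su: "s < u" "0 < u" by auto
      show "AE \<omega> in N. cond_var N (past_future N {0<..} Y s u) (Y t) \<omega> =
           ?G t s u *
             (1 + - ((\<theta> + 2 * \<tau> * \<Delta>) / (sqrt (v - r + \<tau>) * sqrt (1 + \<theta> * \<Delta> + \<tau> * \<Delta>\<^sup>2)))
                    * ((u * Y s \<omega> - s * Y u \<omega>) / (u - s))
                + (\<theta> + 2 * \<tau> * \<Delta>) / (sqrt (v - r + \<tau>) * sqrt (1 + \<theta> * \<Delta> + \<tau> * \<Delta>\<^sup>2))
                    * ((Y u \<omega> - Y s \<omega>) / (u - s))
                + \<tau> / (v - r + \<tau>) * ((u * Y s \<omega> - s * Y u \<omega>)\<^sup>2 / (u - s)\<^sup>2)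
                + \<tau> / (v - r + \<tau>) * ((Y u \<omega> - Y s \<omega>)\<^sup>2 / (u - s)\<^sup>2)
                - (1 - (v - r - \<tau>) / (v - r + \<tau>))
                    * ((Y u \<omega> - Y s \<omega>) * (u * Y s \<omega> - s * Y u \<omega>) / (u - s)\<^sup>2))"
        using cond(2)[OF st] AE_space
      proof eventually_elim
        case (elim \<omega>)
        \<comment> \<open>The expansion is written in explicit affine images of the values of
          \<open>X\<close>; folding recognises them as \<open>Y s\<close> and \<open>Y u\<close>,
          which is valid as \<omega> lies in \<open>space N\<close>.\<close>
        note form = meixner_form_time_change[OF assms(3,6) st(1) su(1) assms(8,9),
            of "X (\<phi> s) \<omega>" "X (\<phi> u) \<omega>", folded c_def w_def, folded k_def \<phi>_def,
            folded Y_raw[OF st(1) elim(2)] Y_raw[OF su(2) elim(2)]]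
        show ?case
          unfolding elim(1) form c_def[symmetric] w_def[symmetric]
          by (simp only: power_divide times_divide_times_eq power2_eq_square mult.assoc)
      qed
    qed
  qed
qed

end
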